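(* Let $\mathcal{H}$ be a real Hilbert space, let $\gamma>0$, $u_0,v_0\in\mathcal{H}$, and let $\phi,\psi,\beta$ satisfy the following conditions. $(H_\psi)$ $\psi:\mathcal{H}\to[0,+\infty)$ is convex and Fréchet differentiable with Lipschitz continuous gradient, and $\operatorname{argmin}\psi=\psi^{-1}(0)\neq\emptyset$. $(H_\phi)$ $\phi:\mathcal{H}\to\mathbb{R}$ is convex, Fréchet differentiable with Lipschitz continuous gradient, bounded from below, and $S:=\{z\in\operatorname{argmin}\psi:\ \phi(z)\le\phi(x)\ \ \forall x\in\operatorname{argmin}\psi\}\neq\emptyset$. $(H_\beta)$ $\beta:[0,+\infty)\to(0,+\infty)$ is a $C^1$-function and there is a constant $k$ with $0\le k<\gamma$ such that $0\le\dot\beta(t)\le k\beta(t)$ for all $t\ge 0$. $(H)$ For every $p\in\operatorname{ran}N_{\operatorname{argmin}\psi}$, $$\int_0^{+\infty}\beta(t)\left[\psi^*\left(\frac{p}{\beta(t)}\right)-\sigma_{\operatorname{argmin}\psi}\left(\frac{p}{\beta(t)}\right)\right]dt<+\infty.$$ Suppose in addition that $\lim_{t\to+\infty}\beta(t)=+\infty$. Let $x:[0,+\infty)\to\mathcal{H}$ be the (unique) strong global solution of $$\ddot x(t)+\gamma\dot x(t)+\nabla\phi(x(t))+\beta(t)\nabla\psi(x(t))=0,\qquad x(0)=u_0,\ \dot x(0)=v_0.$$ Then the following statements are true: (i) $\phi(x(t))$ converges to $\inf_{y\in\operatorname{argmin}\psi}\phi(y)$ as $t\to+\infty$; (ii)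 $\lim_{t\to+\infty}\beta(t)\psi(x(t))=\lim_{t\to+\infty}\psi(x(t))=0$; (iii) $\int_0^{+\infty}\beta(t)\psi(x(t))\,dt<+\infty$; (iv) $\int_0^{+\infty}\|\dot x(t)\|^2\,dt<+\infty$; (v) $\lim_{t\to+\infty}\dot x(t)=0$; (vi) there exists $x_\infty\in S$ such that $x(t)$ converges weakly to $x_\infty$ as $t\to+\infty$.
   Context: $\operatorname{argmin}\psi$ is the set of minimizers of $\psi$ over $\mathcal{H}$. The Fenchel conjugate of $\psi$ is $\psi^*:\mathcal{H}\to\mathbb{R}\cup\{+\infty\}$, $\psi^*(p)=\sup_{x\in\mathcal{H}}\{\langle p,x\rangle-\psi(x)\}$. The support function of $\operatorname{argmin}\psi$ is $\sigma_{\operatorname{argmin}\psi}(p)=\sup_{x\in\operatorname{argmin}\psi}\langle p,x\rangle\in\mathbb{R}\cup\{+\infty\}$. The normal cone is $N_{\operatorname{argmin}\psi}(x)=\{p\in\mathcal{H}:\langle p,y-x\rangle\le 0\ \ \forall y\in\operatorname{argmin}\psi\}$ for $x\in\operatorname{argmin}\psi$ and $N_{\operatorname{argmin}\psi}(x)=\emptyset$ otherwise; its range $\operatorname{ran}N_{\operatorname{argmin}\psi}$ is the set of all $p$ such that $p\in N_{\operatorname{argmin}\psi}(x)$ for some $x\in\operatorname{argmin}\psi$. A function $x:[0,+\infty)\to\mathcal{H}$ is a strong global solution of the system if $x$ and $\dot x$ are locally absolutely continuous (absolutely continuous on each interval $[0,b]$, $0<b<+\infty$), $x(0)=u_0$,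 $\dot x(0)=v_0$, and the differential equation holds for almost every $t\in[0,+\infty)$. Under the stated assumptions such a solution exists and is unique (Cauchy–Lipschitz–Picard). *)

theory Defs
  imports "HOL-Analysis.Analysis"
begin

text \<open>Real Hilbert spaces are types of sort \<open>{real_inner, complete_space}\<close>. A map defined on
  \<open>[0, +\<infinity>)\<close> is a total function on \<open>real\<close> of which only the values on \<open>{0..}\<close> matter;
  in particular all its derivatives are taken within \<open>{0..}\<close>, hence one-sided at \<open>0\<close>.\<close>

text \<open>The vector \<open>D\<close> exists for Frechet differentiable \<open>f\<close> by completeness (Riesz).\<close>

definition gradient :: "('a::real_inner \<Rightarrow> real) \<Rightarrow> 'a \<Rightarrow> 'a" where
  "gradient f x = (THE D. GDERIV f x :> D)"

definition argmin_on :: "'a set \<Rightarrow> ('a \<Rightarrow> real) \<Rightarrow> 'a set" where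
  "argmin_on A f = {z. is_arg_min f (\<lambda>x. x \<in> A) z}"

abbreviation argmin :: "('a \<Rightarrow> real) \<Rightarrow> 'a set" where
  "argmin f \<equiv> argmin_on UNIV f"

definition fenchel_conjugate :: "('a::real_inner \<Rightarrow> real) \<Rightarrow> 'a \<Rightarrow> ereal" where
  "fenchel_conjugate f p = (SUP x. ereal (inner p x - f x))"

definition support_function :: "'a::real_inner set \<Rightarrow> 'a \<Rightarrow> ereal" where
  "support_function C p = (SUP x\<in>C. ereal (inner p x))"

definition normal_cone :: "'a::real_inner set \<Rightarrow> 'a \<Rightarrow> 'a set" where
  "normal_cone C x = (if x \<in> C then {p. \<forall>y\<in>C. inner p (y - x) \<le> 0} else {})"

definition ran_normal_cone :: "'a::real_inner set \<Rightarrow> 'a set" where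
  "ran_normal_cone C = (\<Union>x. normal_cone C x)"

definition absolutely_continuous_on_Icc ::
    "real \<Rightarrow> real \<Rightarrow> (real \<Rightarrow> 'a::real_normed_vector) \<Rightarrow> bool" where
  "absolutely_continuous_on_Icc a b f \<longleftrightarrow>
     (\<forall>\<epsilon>>0. \<exists>\<delta>>0. \<forall>(n::nat) (l::nat \<Rightarrow> real) (r::nat \<Rightarrow> real).
        (\<forall>i<n. a \<le> l i \<and> l i \<le> r i \<and> r i \<le> b) \<and>
        disjoint_family_on (\<lambda>i. {l i<..<r i}) {..<n} \<and>
        (\<Sum>i<n. r i - l i) < \<delta> \<longrightarrow>
        (\<Sum>i<n. norm (f (r i) - f (l i))) < \<epsilon>)"

definition locally_absolutely_continuous :: "(real \<Rightarrow> 'a::real_normed_vector) \<Rightarrow> bool" where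
  "locally_absolutely_continuous f \<longleftrightarrow> (\<forall>b>0. absolutely_continuous_on_Icc 0 b f)"

definition time_deriv :: "(real \<Rightarrow> 'a::real_normed_vector) \<Rightarrow> real \<Rightarrow> 'a" where
  "time_deriv f t = vector_derivative f (at t within {0..})"

text \<open>Requiring \<open>time_deriv x\<close> to be absolutely continuous presupposes that it is defined at every
  \<open>t \<ge> 0\<close>; as \<open>vector_derivative\<close> is total, this is stated explicitly. The second derivative
  need only exist almost everywhere.\<close>

definition strong_global_solution ::
    "real \<Rightarrow> ('a::real_inner \<Rightarrow> real) \<Rightarrow> ('a \<Rightarrow> real) \<Rightarrow> (real \<Rightarrow> real) \<Rightarrow> 'a \<Rightarrow> 'a \<Rightarrow>
     (real \<Rightarrow> 'a) \<Rightarrow> bool" where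
  "strong_global_solution \<gamma> \<phi> \<psi> \<beta> u\<^sub>0 v\<^sub>0 x \<longleftrightarrow>
     (\<forall>t\<ge>0. x differentiable (at t within {0..})) \<and>
     locally_absolutely_continuous x \<and>
     locally_absolutely_continuous (time_deriv x) \<and>
     x 0 = u\<^sub>0 \<and> time_deriv x 0 = v\<^sub>0 \<and>
     (AE t in lborel. 0 \<le> t \<longrightarrow>
        time_deriv x differentiable (at t within {0..}) \<and>
        time_deriv (time_deriv x) t + \<gamma> *\<^sub>R time_deriv x t + gradient \<phi> (x t) + \<beta> t *\<^sub>R gradient \<psi> (x t) = 0)"

definition weakly_tendsto :: "('b \<Rightarrow> 'a::real_inner) \<Rightarrow> 'a \<Rightarrow> 'b filter \<Rightarrow> bool" where
  "weakly_tendsto f l F \<longleftrightarrow> (\<forall>y. ((\<lambda>t. inner (f t) y) \<longlongrightarrow> inner l y) F)"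

end

theory Submission
  imports Defs
begin


text \<open>
  Write \<open>C\<close> for the zero set of \<open>\<psi>\<close> and \<open>S\<close> for the minimizers of \<open>\<phi>\<close> over \<open>C\<close>, fix
  \<open>z \<in> S\<close>, and let \<open>v\<close> be the velocity. The energy
  \<open>E = \<parallel>v\<parallel>\<^sup>2/2 + \<phi>(x) + \<beta> \<psi>(x)\<close> is damped by friction but pumped by the growth of
  \<open>\<beta>\<close>: \<open>E' = \<beta>' \<psi>(x) - \<gamma> \<parallel>v\<parallel>\<^sup>2\<close>, where the pumping is at most \<open>k \<beta> \<psi>(x)\<close>. With
  \<open>h = \<parallel>x - z\<parallel>\<^sup>2/2\<close>, convexity makes \<open>h' + \<gamma> h\<close> (the anchor) dissipate the penalty,
  \<open>(h' + \<gamma> h)' \<le> \<parallel>v\<parallel>\<^sup>2 - \<beta> \<psi>(x) - \<langle>\<nabla>\<phi>(z), x - z\<rangle>\<close>. As \<open>k < \<gamma>\<close>, a suitable \<open>c > 0\<close> and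
  \<open>\<delta> > 0\<close> give, for \<open>W = h' + \<gamma> h + c E\<close>,
  \<open>W' \<le> - \<delta> \<parallel>v\<parallel>\<^sup>2 - \<delta> \<beta> \<psi>(x) - \<langle>\<nabla>\<phi>(z), x - z\<rangle>\<close>.
  The last term has no sign, because \<open>x\<close> is not in \<open>C\<close>. But \<open>-\<nabla>\<phi>(z)\<close> is normal to \<open>C\<close> at
  \<open>z\<close>, and for a normal \<open>q\<close> the Fenchel inequality bounds \<open>\<langle>q, x - z\<rangle> - \<beta> \<psi>(x)\<close> by
  \<open>\<beta> (\<psi>\<^sup>*(q/\<beta>) - \<sigma>(q/\<beta>))\<close>, whose integral over the half-line is finite
  (\<open>penalty_excess_integral_bounded\<close>). Half of the penalty dissipation pays for this, the other
  half remains. Since \<open>W\<close> is bounded below, \<open>\<parallel>v\<parallel>\<^sup>2\<close> and \<open>\<beta> \<psi>(x)\<close> are integrable and \<open>W\<close>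
  converges; given these integrals, \<open>E\<close> converges as well.

  The limit of \<open>E\<close> is \<open>\<phi>(z)\<close>. It is not larger, as
  \<open>(h' + \<gamma> h)' \<le> 3/2 \<parallel>v\<parallel>\<^sup>2 - (E - \<phi>(z))\<close> would otherwise drive \<open>h' + \<gamma> h = W - c E\<close> to
  \<open>-\<infinity>\<close> (\<open>energy_limit_le\<close>). It is not smaller, as \<open>\<psi>(x)\<close> is \<open>O(1/\<beta>)\<close>, so that weak cluster
  points of \<open>x\<close> lie in \<open>C\<close> and weak lower semicontinuity gives \<open>liminf \<phi>(x) \<ge> \<phi>(z)\<close>
  (\<open>objective_eventually_ge\<close>). The nonnegative rest \<open>\<parallel>v\<parallel>\<^sup>2/2 + \<beta> \<psi>(x)\<close> of the energy therefore
  vanishes in the limit and \<open>\<phi>(x)\<close> tends to \<open>\<phi>(z)\<close>. Weak cluster points of \<open>x\<close> are then in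
  \<open>S\<close>, and \<open>\<parallel>x - z\<parallel>\<close> converges because \<open>h' + \<gamma> h\<close> converges and \<open>h'\<close> tends to \<open>0\<close>; Opial's
  lemma yields weak convergence.

  Two tools stand apart. A strong solution satisfies the equation almost everywhere only; as its
  right-hand side is continuous, the fundamental theorem of calculus for absolutely continuous
  functions upgrades this to every time (\<open>locally_absolutely_continuous_C1\<close>), after which only
  ordinary derivatives occur. Bounded trajectories have weak cluster points by Tychonoff's theorem
  and the Riesz representation theorem, with finer filters in the role of subsequences.
\<close>
section \<open>Gradients in Hilbert spaces\<close>

text \<open>The representing vector is the minimizer of \<open>y \<mapsto> \<parallel>y\<parallel>\<^sup>2/2 - f y\<close>: the parallelogram law makes
  every minimizing sequence Cauchy, and the first-order condition at the minimizer \<open>D\<close> is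
  \<open>f h = \<langle>h, D\<rangle>\<close>.\<close>
lemma Riesz_representation:
  fixes f :: "'a::{real_inner, complete_space} \<Rightarrow> real"
  assumes f: "bounded_linear f"
  obtains D where "\<And>h. f h = inner h D"
proof -
  interpret bounded_linear f by (rule f)
  define J where "J y = (norm y)\<^sup>2 / 2 - f y" for y
  obtain K where K: "\<And>y. \<bar>f y\<bar> \<le> norm y * K"
    using bounded by auto
  have J_ge: "J y \<ge> - K\<^sup>2 / 2" for y
  proof -
    have "0 \<le> (norm y - K)\<^sup>2" by simp
    then show ?thesis using K[of y] by (simp add: J_def power2_diff)
  qed
  define m where "m = Inf (range J)"
  have bdd: "bdd_below (range J)" using J_ge by (auto simp: bdd_below_def)
  have m_le: "m \<le> J y" for y unfolding m_def by (rule cInf_lower) (use bdd in auto)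
  have "\<exists>y. J y < m + 1 / Suc n" for n
    using cInf_lessD[of "range J" "m + 1 / Suc n"] by (auto simp: m_def)
  then obtain y where y: "\<And>n. J (y n) < m + 1 / Suc n" by metis
  \<comment> \<open>parallelogram law, comparing the value at the midpoint with the infimum\<close>
  have par: "(norm (a - b))\<^sup>2 \<le> 4 * J a + 4 * J b - 8 * m" for a b
  proof -
    have "J ((1/2) *\<^sub>R (a + b)) = (J a + J b) / 2 - (norm (a - b))\<^sup>2 / 8"
      by (simp add: J_def add scale power2_norm_eq_inner inner_add inner_diff inner_commute field_simps)
    then have "m \<le> (J a + J b) / 2 - (norm (a - b))\<^sup>2 / 8" using m_le by metis
    then show ?thesis by (simp add: field_simps)
  qed
  have "Cauchy y"
  proof (rule metric_CauchyI)
    fix e :: real assume e: "e > 0"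
    obtain N where N: "1 / Suc N < e\<^sup>2 / 8"
      using reals_Archimedean[of "e\<^sup>2/8"] e by (auto simp: inverse_eq_divide)
    have "dist (y i) (y j) < e" if "i \<ge> N" "j \<ge> N" for i j
    proof -
      have "1 / real (Suc i) \<le> 1 / Suc N" "1 / real (Suc j) \<le> 1 / Suc N"
        using that by (auto intro!: divide_left_mono)
      then have "(norm (y i - y j))\<^sup>2 < e\<^sup>2"
        using par[of "y i" "y j"] y[of i] y[of j] N by linarith
      then show ?thesis using e by (simp add: dist_norm power_less_imp_less_base)
    qed
    then show "\<exists>M. \<forall>i\<ge>M. \<forall>j\<ge>M. dist (y i) (y j) < e" by blast
  qed
  then obtain D where D: "y \<longlonglongrightarrow> D" using Cauchy_convergent convergent_def by blast
  have "(\<lambda>n. J (y n)) \<longlonglongrightarrow> J D" unfolding J_def by (intro tendsto_intros D tendsto) simp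
  moreover have "(\<lambda>n. m + 1 / Suc n) \<longlonglongrightarrow> m + 0"
    by (rule tendsto_add[OF tendsto_const LIMSEQ_Suc[OF lim_1_over_n]])
  ultimately have JD: "J D \<le> m"
    using y by (intro LIMSEQ_le[of "\<lambda>n. J (y n)" _ "\<lambda>n. m + 1 / Suc n"]) (auto intro: less_imp_le)
  have "f h = inner h D" for h
  proof -
    define e where "e = inner h D - f h"
    define n where "n = (norm h)\<^sup>2"
    have n: "n \<ge> 0" by (simp add: n_def)
    \<comment> \<open>a step along \<open>h\<close> against the slope \<open>e\<close>, short enough for the quadratic term to lose\<close>
    define s where "s = - e / (n + 1)"
    have "(norm (D + s *\<^sub>R h))\<^sup>2 = (norm D)\<^sup>2 + 2 * s * inner h D + s\<^sup>2 * (norm h)\<^sup>2"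
      unfolding power2_norm_eq_inner
      by (simp add: inner_add inner_commute power2_eq_square algebra_simps)
    then have "J (D + s *\<^sub>R h) = J D + s * e + s\<^sup>2 * n / 2"
      by (simp add: J_def e_def n_def add scale field_simps)
    then have "0 \<le> s * e + s\<^sup>2 * n / 2" using m_le[of "D + s *\<^sub>R h"] JD by simp
    also have "\<dots> = - (e / (n + 1))\<^sup>2 * (n + 2) / 2"
      using n by (simp add: s_def power2_eq_square divide_simps) (simp add: algebra_simps)
    finally have "(e / (n + 1))\<^sup>2 * (n + 2) \<le> 0" by simp
    then have "(e / (n + 1))\<^sup>2 \<le> 0" using n by (simp add: mult_le_0_iff)
    then have "e = 0" using n by simp
    then show ?thesis by (simp add: e_def)
  qed
  then show thesis using that by blast
qed

lemma GDERIV_unique: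
  assumes "GDERIV f x :> D" "GDERIV f x :> E" shows "D = E"
proof -
  have "(\<lambda>h. inner h D) = (\<lambda>h. inner h E)"
    using assms has_derivative_unique unfolding gderiv_def by blast
  then have "inner (D - E) D = inner (D - E) E" by metis
  then have "inner (D - E) (D - E) = 0" by (simp add: inner_diff_right)
  then show ?thesis by simp
qed

lemma GDERIV_gradient:
  fixes f :: "'a::{real_inner, complete_space} \<Rightarrow> real"
  assumes "f differentiable (at x)"
  shows "GDERIV f x :> gradient f x"
proof -
  obtain f' where f': "(f has_derivative f') (at x)" using assms by (auto simp: differentiable_def)
  obtain D where "\<And>h. f' h = inner h D"
    using Riesz_representation[OF has_derivative_bounded_linear[OF f']] by blast
  then have "f' = (\<lambda>h. inner h D)" by auto
  then have "GDERIV f x :> D" using f' by (simp add: gderiv_def)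
  then show ?thesis unfolding gradient_def by (rule theI) (blast intro: GDERIV_unique[OF _ \<open>GDERIV f x :> D\<close>])
qed

lemma has_real_derivative_along_curve:
  fixes u :: "real \<Rightarrow> 'a::real_inner"
  assumes "GDERIV f (u t) :> D" "(u has_vector_derivative u') (at t within A)"
  shows "((\<lambda>s. f (u s)) has_real_derivative inner D u') (at t within A)"
proof -
  have "((\<lambda>s. f (u s)) has_derivative (\<lambda>h. inner (h *\<^sub>R u') D)) (at t within A)"
    using has_derivative_compose[OF assms(2)[unfolded has_vector_derivative_def] assms(1)[unfolded gderiv_def]] .
  then show ?thesis
    by (simp add: has_field_derivative_def inner_commute[of D] mult_commute_abs mult.commute)
qed

lemma convex_GDERIV_below:
  fixes f :: "'a::real_inner \<Rightarrow> real"
  assumes "convex_on UNIV f" "GDERIV f x :> D"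
  shows "f x + inner D (y - x) \<le> f y"
proof -
  define l where "l s = x + s *\<^sub>R (y - x)" for s :: real
  have conv: "convex_on UNIV (\<lambda>s. f (l s))"
  proof (rule convex_onI)
    fix t a b :: real assume "0 < t" "t < 1"
    moreover have "l ((1 - t) *\<^sub>R a + t *\<^sub>R b) = (1 - t) *\<^sub>R l a + t *\<^sub>R l b"
      by (simp add: l_def algebra_simps)
    ultimately show "f (l ((1 - t) *\<^sub>R a + t *\<^sub>R b)) \<le> (1 - t) * f (l a) + t * f (l b)"
      using convex_onD[OF assms(1), of t "l a" "l b"] by simp
  qed simp
  have "(l has_vector_derivative (y - x)) (at 0)"
    unfolding l_def by (auto intro!: derivative_eq_intros)
  then have "((\<lambda>s. f (l s)) has_real_derivative inner D (y - x)) (at 0)"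
    using assms(2) by (intro has_real_derivative_along_curve) (auto simp: l_def[of 0])
  from convex_on_imp_above_tangent[OF conv connected_UNIV _ _ this, of 1]
  show ?thesis by (simp add: l_def)
qed

text \<open>Moving from \<open>z\<close> towards \<open>y\<close> stays in \<open>C\<close>, so the directional derivative cannot be negative.\<close>
lemma minimizer_variational_inequality:
  fixes f :: "'a::real_inner \<Rightarrow> real"
  assumes "convex C" "z \<in> C" "\<And>y. y \<in> C \<Longrightarrow> f z \<le> f y" "GDERIV f z :> D" "y \<in> C"
  shows "0 \<le> inner D (y - z)"
proof (rule ccontr)
  assume neg: "\<not> 0 \<le> inner D (y - z)"
  define l where "l s = z + s *\<^sub>R (y - z)" for s :: real
  have "(l has_vector_derivative (y - z)) (at 0)"
    unfolding l_def by (auto intro!: derivative_eq_intros)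
  then have "((\<lambda>s. f (l s)) has_real_derivative inner D (y - z)) (at 0)"
    using assms(4) by (intro has_real_derivative_along_curve) (auto simp: l_def[of 0])
  from DERIV_neg_dec_right[OF this] neg obtain d where d: "d > 0"
    "\<And>h. 0 < h \<Longrightarrow> h < d \<Longrightarrow> f (l h) < f z" by (auto simp: l_def)
  define h where "h = min (d/2) 1"
  have h: "0 < h" "h < d" "h \<le> 1" using d(1) by (auto simp: h_def)
  have "l h = (1 - h) *\<^sub>R z + h *\<^sub>R y" by (simp add: l_def algebra_simps)
  then have "l h \<in> C" using convexD_alt[OF assms(1,2,5), of h] h by simp
  then show False using assms(3) d(2)[OF h(1,2)] by fastforce
qed

section \<open>Weak convergence\<close>

text \<open>The functionals \<open>y \<mapsto> \<langle>x t, y\<rangle>\<close> eventually lie in a product of compact intervals, which is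
  compact by Tychonoff's theorem. A cluster point is again linear and bounded, hence represented
  by a vector. The finer filter \<open>G\<close> takes the place of a convergent subsequence.\<close>
lemma bounded_imp_weak_cluster_point:
  fixes x :: "'b \<Rightarrow> 'a::{real_inner, complete_space}"
  assumes "F \<noteq> bot" and bdd: "\<forall>\<^sub>F t in F. norm (x t) \<le> B"
  obtains l G where "G \<noteq> bot" "G \<le> F" "weakly_tendsto x l G"
proof -
  define K :: "('a \<Rightarrow> real) set" where "K = PiE UNIV (\<lambda>y. cball 0 (B * norm y))"
  have "compactin (product_topology (\<lambda>_. euclidean) UNIV) K"
    unfolding K_def compactin_PiE by simp
  then have "compact K" by (simp add: euclidean_product_topology)
  moreover have "filtermap (\<lambda>t y. inner (x t) y) F \<noteq> bot" using assms(1) by (simp add: filtermap_bot_iff)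
  moreover have "\<forall>\<^sub>F \<xi> in filtermap (\<lambda>t y. inner (x t) y) F. \<xi> \<in> K"
    unfolding eventually_filtermap using bdd
  proof eventually_elim
    case (elim t)
    have "\<bar>inner (x t) y\<bar> \<le> B * norm y" for y
      using Cauchy_Schwarz_ineq2[of "x t" y] mult_right_mono[OF elim, of "norm y"] by simp
    then show ?case by (auto simp: K_def)
  qed
  ultimately obtain \<xi> where \<xi>: "\<xi> \<in> K" "inf (nhds \<xi>) (filtermap (\<lambda>t y. inner (x t) y) F) \<noteq> bot"
    unfolding compact_filter by blast
  define G where "G = inf F (filtercomap (\<lambda>t y. inner (x t) y) (nhds \<xi>))"
  have "G \<noteq> bot"
  proof
    assume "G = bot"
    then have "eventually (\<lambda>_. False) G" by simp
    then obtain P Q where P: "eventually P F" "eventually Q (nhds \<xi>)"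
        "\<And>t. P t \<Longrightarrow> Q (\<lambda>y. inner (x t) y) \<Longrightarrow> False"
      unfolding G_def eventually_inf eventually_filtercomap by (metis (no_types, lifting))
    have "eventually (\<lambda>\<eta>. \<not> Q \<eta>) (filtermap (\<lambda>t y. inner (x t) y) F)"
      unfolding eventually_filtermap
      by (intro eventually_mono[OF P(1)] notI) (rule P(3))
    with P(2) have "eventually (\<lambda>_. False) (inf (nhds \<xi>) (filtermap (\<lambda>t y. inner (x t) y) F))"
      unfolding eventually_inf by blast
    with \<xi>(2) show False by (simp add: eventually_False)
  qed
  have lim: "((\<lambda>t. inner (x t) y) \<longlongrightarrow> \<xi> y) G" for y
  proof -
    have "filterlim (\<lambda>t y. inner (x t) y) (nhds \<xi>) G"
      unfolding G_def by (rule filterlim_mono[OF filterlim_filtercomap order_refl inf_le2])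
    moreover have "((\<lambda>\<eta>. \<eta> y) \<longlongrightarrow> \<xi> y) (nhds \<xi>)"
    proof (rule topological_tendstoI)
      fix A :: "real set" assume A: "open A" "\<xi> y \<in> A"
      have "open ((\<lambda>\<eta>. \<eta> y) -` A)" by (rule open_vimage[OF A(1) continuous_on_product_coordinates])
      then show "\<forall>\<^sub>F \<eta> in nhds \<xi>. \<eta> y \<in> A" using A(2) unfolding eventually_nhds by blast
    qed
    ultimately show ?thesis using filterlim_compose by blast
  qed
  have "linear \<xi>"
  proof
    fix a b :: 'a and r :: real
    show "\<xi> (a + b) = \<xi> a + \<xi> b"
      by (rule tendsto_unique[OF \<open>G \<noteq> bot\<close> lim]) (auto simp: inner_add_right intro!: tendsto_intros lim)
    show "\<xi> (r *\<^sub>R a) = r *\<^sub>R \<xi> a"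
      by (rule tendsto_unique[OF \<open>G \<noteq> bot\<close> lim]) (auto intro!: tendsto_intros lim)
  qed
  moreover have "norm (\<xi> y) \<le> norm y * B" for y
    using \<xi>(1) by (auto simp: K_def mult.commute)
  ultimately have "bounded_linear \<xi>"
    by (intro bounded_linear_intro) (auto simp: linear_add linear_scale)
  then obtain l where "\<And>y. \<xi> y = inner y l" using Riesz_representation by blast
  then have "weakly_tendsto x l G" using lim by (simp add: weakly_tendsto_def inner_commute)
  moreover have "G \<le> F" by (simp add: G_def)
  ultimately show thesis using that \<open>G \<noteq> bot\<close> by blast
qed

text \<open>Weak lower semicontinuity: \<open>f\<close> lies above its tangent at \<open>l\<close>, and the tangent, being affine and
  continuous, passes to the weak limit.\<close>
lemma weak_limit_value_le:
  fixes f :: "'a::real_inner \<Rightarrow> real"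
  assumes "convex_on UNIV f" "GDERIV f l :> D" "weakly_tendsto x l G" "G \<noteq> bot"
    and "\<forall>\<^sub>F t in G. f (x t) \<le> c"
  shows "f l \<le> c"
proof (rule tendsto_upperbound[OF _ _ assms(4)])
  have "((\<lambda>t. f l + (inner (x t) D - inner l D)) \<longlongrightarrow> f l + (inner l D - inner l D)) G"
    by (intro tendsto_intros assms(3)[unfolded weakly_tendsto_def, rule_format])
  then show "((\<lambda>t. f l + (inner (x t) D - inner l D)) \<longlongrightarrow> f l) G" by simp
  show "\<forall>\<^sub>F t in G. f l + (inner (x t) D - inner l D) \<le> c"
    using assms(5)
  proof eventually_elim
    case (elim t)
    then show ?case
      using convex_GDERIV_below[OF assms(1,2), of "x t"] by (simp add: inner_diff_right inner_commute[of D])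
  qed
qed

text \<open>If \<open>l\<close> and \<open>l'\<close> are two weak cluster points, then \<open>\<parallel>x - l\<parallel>\<^sup>2 - \<parallel>x - l'\<parallel>\<^sup>2\<close> converges, hence so
  does \<open>\<langle>x, l' - l\<rangle>\<close>. Its limit is both \<open>\<langle>l, l' - l\<rangle>\<close> and \<open>\<langle>l', l' - l\<rangle>\<close>, which forces \<open>l = l'\<close>. A
  bounded family with a single weak cluster point converges weakly.\<close>
lemma Opial:
  fixes x :: "'b \<Rightarrow> 'a::{real_inner, complete_space}"
  assumes F: "F \<noteq> bot" and bdd: "\<forall>\<^sub>F t in F. norm (x t) \<le> B"
    and dist: "\<And>z. z \<in> S \<Longrightarrow> \<exists>r. ((\<lambda>t. (norm (x t - z))\<^sup>2) \<longlongrightarrow> r) F"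
    and cluster: "\<And>l G. G \<noteq> bot \<Longrightarrow> G \<le> F \<Longrightarrow> weakly_tendsto x l G \<Longrightarrow> l \<in> S"
  obtains l where "l \<in> S" "weakly_tendsto x l F"
proof -
  obtain l G where l: "G \<noteq> bot" "G \<le> F" "weakly_tendsto x l G"
    using bounded_imp_weak_cluster_point[OF F bdd] by blast
  have lS: "l \<in> S" using cluster l by blast
  have unique: "l' = l" if l': "G' \<noteq> bot" "G' \<le> F" "weakly_tendsto x l' G'" for l' G'
  proof -
    define d where "d = l' - l"
    have "l' \<in> S" using cluster l' by blast
    then obtain r r' where r: "((\<lambda>t. (norm (x t - l))\<^sup>2) \<longlongrightarrow> r) F" "((\<lambda>t. (norm (x t - l'))\<^sup>2) \<longlongrightarrow> r') F"
      using dist lS by metis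
    have "((\<lambda>t. ((norm (x t - l))\<^sup>2 - (norm (x t - l'))\<^sup>2 + (norm l')\<^sup>2 - (norm l)\<^sup>2) / 2)
        \<longlongrightarrow> (r - r' + (norm l')\<^sup>2 - (norm l)\<^sup>2) / 2) F"
      by (intro tendsto_intros r) simp
    also have "(\<lambda>t. ((norm (x t - l))\<^sup>2 - (norm (x t - l'))\<^sup>2 + (norm l')\<^sup>2 - (norm l)\<^sup>2) / 2)
        = (\<lambda>t. inner (x t) d)"
      by (simp add: d_def power2_norm_eq_inner inner_diff inner_commute diff_divide_distrib)
    finally obtain q where q: "((\<lambda>t. inner (x t) d) \<longlongrightarrow> q) F" by blast
    have "inner l d = q"
      using l q tendsto_mono tendsto_unique unfolding weakly_tendsto_def by metis
    moreover have "inner l' d = q"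
      using l' q tendsto_mono tendsto_unique unfolding weakly_tendsto_def by metis
    ultimately have "inner d d = 0" by (simp add: d_def inner_diff_left)
    then show ?thesis by (simp add: d_def)
  qed
  have "((\<lambda>t. inner (x t) y) \<longlongrightarrow> inner l y) F" for y
  proof (rule tendstoI, rule ccontr)
    fix e :: real assume e: "e > 0"
    define A where "A = {t. \<not> dist (inner (x t) y) (inner l y) < e}"
    assume "\<not> (\<forall>\<^sub>F t in F. dist (inner (x t) y) (inner l y) < e)"
    then have "inf F (principal A) \<noteq> bot"
      by (simp add: A_def trivial_limit_def eventually_inf_principal)
    moreover have "\<forall>\<^sub>F t in inf F (principal A). norm (x t) \<le> B"
      using bdd by (auto simp: eventually_inf_principal elim: eventually_mono)
    ultimately obtain l' G' where G': "G' \<noteq> bot" "G' \<le> inf F (principal A)" "weakly_tendsto x l' G'"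
      using bounded_imp_weak_cluster_point by blast
    then have "l' = l" using unique by simp
    then have "\<forall>\<^sub>F t in G'. dist (inner (x t) y) (inner l y) < e"
      using G'(3) e unfolding weakly_tendsto_def by (auto dest: tendstoD)
    moreover have "\<forall>\<^sub>F t in G'. t \<in> A" using G'(2) by (simp add: le_principal)
    ultimately have "\<forall>\<^sub>F t in G'. False" by eventually_elim (simp add: A_def)
    then show False using G'(1) by (simp add: trivial_limit_def)
  qed
  then show thesis using that lS by (simp add: weakly_tendsto_def)
qed

section \<open>Absolutely continuous functions\<close>

lemma absolutely_continuous_on_Icc_finite_family:
  assumes "absolutely_continuous_on_Icc a b f" "e > 0"
  obtains d where "d > 0"
    "\<And>(I :: 'i set) l r. finite I \<Longrightarrow> (\<And>i. i \<in> I \<Longrightarrow> a \<le> l i \<and> l i \<le> r i \<and> r i \<le> b) \<Longrightarrow>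
       disjoint_family_on (\<lambda>i. {l i<..<r i}) I \<Longrightarrow> (\<Sum>i\<in>I. r i - l i) < d \<Longrightarrow>
       (\<Sum>i\<in>I. norm (f (r i) - f (l i))) < e"
proof -
  obtain d where d: "d > 0"
    "\<And>n l r. (\<forall>i<n. a \<le> l i \<and> l i \<le> r i \<and> r i \<le> b) \<and>
        disjoint_family_on (\<lambda>i. {l i<..<r i}) {..<n::nat} \<and> (\<Sum>i<n. r i - l i) < d \<Longrightarrow>
        (\<Sum>i<n. norm (f (r i) - f (l i))) < e"
    using assms unfolding absolutely_continuous_on_Icc_def by meson
  have "(\<Sum>i\<in>I. norm (f (r i) - f (l i))) < e"
    if I: "finite I" "\<And>i. i \<in> I \<Longrightarrow> a \<le> l i \<and> l i \<le> r i \<and> r i \<le> b"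
      "disjoint_family_on (\<lambda>i. {l i<..<r i}) I" "(\<Sum>i\<in>I. r i - l i) < d"
    for I :: "'i set" and l r
  proof -
    obtain h where h: "bij_betw h {..<card I} I"
      using ex_bij_betw_nat_finite[OF I(1)] by (auto simp: atLeast0LessThan)
    have "\<forall>i<card I. a \<le> l (h i) \<and> l (h i) \<le> r (h i) \<and> r (h i) \<le> b"
      using h I(2) by (auto simp: bij_betw_def)
    moreover have "disjoint_family_on (\<lambda>i. {l (h i)<..<r (h i)}) {..<card I}"
      unfolding disjoint_family_on_def
    proof (intro ballI impI)
      fix i j assume "i \<in> {..<card I}" "j \<in> {..<card I}" "i \<noteq> j"
      then have "h i \<in> I" "h j \<in> I" "h i \<noteq> h j" using h by (auto simp: bij_betw_def inj_on_def)
      then show "{l (h i)<..<r (h i)} \<inter> {l (h j)<..<r (h j)} = {}"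
        using I(3) unfolding disjoint_family_on_def by blast
    qed
    moreover have "(\<Sum>i<card I. r (h i) - l (h i)) < d"
      using sum.reindex_bij_betw[OF h, of "\<lambda>i. r i - l i"] I(4) by simp
    ultimately have "(\<Sum>i<card I. norm (f (r (h i)) - f (l (h i)))) < e"
      by (intro d(2)) blast
    then show ?thesis
      using sum.reindex_bij_betw[OF h, of "\<lambda>i. norm (f (r i) - f (l i))"] by simp
  qed
  then show thesis using that d(1) by blast
qed

text \<open>The gauge is chosen so that a fine tagged division splits into two parts. Intervals tagged
  outside \<open>N\<close> are short enough for the derivative to control the increment up to \<open>\<eta>\<close> times their
  length. Intervals tagged in \<open>N\<close> lie in an open set \<open>U \<supseteq> N\<close> of measure below the \<open>d\<close> of absolute
  continuity, so the increments of \<open>f\<close> over them add up to little, and \<open>g = 0\<close> there.\<close>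
lemma FTC_absolutely_continuous:
  fixes f :: "real \<Rightarrow> 'a::real_normed_vector"
  assumes "a \<le> b" and ac: "absolutely_continuous_on_Icc a b f" and N: "negligible N"
    and deriv: "\<And>t. t \<in> {a..b} - N \<Longrightarrow> (f has_vector_derivative f' t) (at t within {a..b})"
  shows "(f' has_integral (f b - f a)) {a..b}"
proof -
  define g where "g t = (if t \<in> N then 0 else f' t)" for t
  have "(g has_integral (f b - f a)) {a..b}"
    unfolding has_integral_real
  proof (intro allI impI)
    fix e :: real assume e: "e > 0"
    \<comment> \<open>the \<open>+ 1\<close> covers the degenerate interval \<open>a = b\<close>\<close>
    define \<eta> where "\<eta> = e / (2 * (b - a + 1))"
    have \<eta>: "\<eta> > 0" "\<eta> * (b - a) < e / 2"
      using e \<open>a \<le> b\<close> by (auto simp: \<eta>_def field_simps)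
    obtain d where d: "d > 0"
      "\<And>(I :: (real \<times> real set) set) l r. finite I \<Longrightarrow> (\<And>i. i \<in> I \<Longrightarrow> a \<le> l i \<and> l i \<le> r i \<and> r i \<le> b) \<Longrightarrow>
       disjoint_family_on (\<lambda>i. {l i<..<r i}) I \<Longrightarrow> (\<Sum>i\<in>I. r i - l i) < d \<Longrightarrow>
       (\<Sum>i\<in>I. norm (f (r i) - f (l i))) < e / 2"
      using absolutely_continuous_on_Icc_finite_family[OF ac, of "e/2", where 'i = "real \<times> real set"] e
      by auto
    obtain U where U: "open U" "N \<subseteq> U" "U - N \<in> lmeasurable" "emeasure lebesgue (U - N) < ennreal d"
      using sets_lebesgue_outer_open[OF negligible_imp_sets[OF N] d(1)] by blast
    have "measure lebesgue (U - N) < d"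
      using U(3,4) d(1) by (simp add: emeasure_eq_measure2 ennreal_less_iff)
    moreover have Udiff: "sym_diff U (U - N) \<subseteq> N" by blast
    ultimately have Um: "U \<in> lmeasurable" "measure lebesgue U < d"
      using lmeasurable_negligible_symdiff[OF U(3), of U] measure_negligible_symdiff[OF U(3), of U]
        negligible_subset[OF N Udiff]
      by (simp_all add: Un_commute)
    have "\<exists>k>0. \<forall>y\<in>{a..b}. norm (y - t) < k \<longrightarrow>
        norm (f y - f t - (y - t) *\<^sub>R f' t) \<le> \<eta> * norm (y - t)" if "t \<in> {a..b} - N" for t
      using deriv[OF that] \<eta>(1) unfolding has_vector_derivative_def has_derivative_within_alt by blast
    then obtain k where k: "\<And>t. t \<in> {a..b} - N \<Longrightarrow> k t > 0"
      "\<And>t y. t \<in> {a..b} - N \<Longrightarrow> y \<in> {a..b} \<Longrightarrow> norm (y - t) < k t \<Longrightarrow>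
         norm (f y - f t - (y - t) *\<^sub>R f' t) \<le> \<eta> * norm (y - t)"
      by metis
    define \<G> where "\<G> t = (if t \<in> N then U else if t \<in> {a..b} then ball t (k t) else ball t 1)" for t
    have gauge: "gauge \<G>"
      using U(1,2) k(1) by (auto simp: gauge_def \<G>_def)
    have small: "norm ((\<Sum>(t, K)\<in>\<D>. measure lborel K *\<^sub>R g t) - (f b - f a)) < e"
      if \<D>: "\<D> tagged_division_of {a..b}" "\<G> fine \<D>" for \<D>
    proof -
      note td = tagged_division_ofD[OF \<D>(1)]
      have K: "a \<le> Inf K \<and> Inf K \<le> t \<and> t \<le> Sup K \<and> Sup K \<le> b" "K \<subseteq> \<G> t"
        and K_eq: "K = {Inf K..Sup K}" if tK: "(t, K) \<in> \<D>" for t K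
      proof -
        obtain u v where "K = cbox u v" using td(4)[OF tK] by blast
        moreover have "t \<in> K" "K \<subseteq> {a..b}" using td(2,3)[OF tK] by auto
        ultimately show "a \<le> Inf K \<and> Inf K \<le> t \<and> t \<le> Sup K \<and> Sup K \<le> b" "K = {Inf K..Sup K}"
          by auto
        show "K \<subseteq> \<G> t" using \<D>(2) tK by (auto simp: fine_def)
      qed
      define \<D>N where "\<D>N = {p \<in> \<D>. fst p \<in> N}"
      \<comment> \<open>the contribution of one tagged interval to the error of the Riemann sum\<close>
      define \<delta> where "\<delta> p = measure lborel (snd p) *\<^sub>R g (fst p) - (f (Sup (snd p)) - f (Inf (snd p)))"
        for p :: "real \<times> real set"
      have len: "(\<Sum>p\<in>\<D>. Sup (snd p) - Inf (snd p)) = b - a"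
        using additive_tagged_division_1[OF \<open>a \<le> b\<close> \<D>(1), of "\<lambda>x. x"] by (simp add: case_prod_beta)
      have off: "norm (\<delta> p) \<le> \<eta> * (Sup (snd p) - Inf (snd p))" if "p \<in> \<D> - \<D>N" for p
      proof -
        obtain t K where p: "p = (t, K)" by fastforce
        define u v where "u = Inf K" and "v = Sup K"
        have tK: "K = {u..v}" "a \<le> u" "u \<le> t" "t \<le> v" "v \<le> b" "K \<subseteq> \<G> t" and tN: "t \<notin> N"
          using K[of t K] K_eq[of t K] that by (auto simp: p \<D>N_def u_def v_def)
        then have t: "t \<in> {a..b} - N" by auto
        then have "K \<subseteq> ball t (k t)" using tK(6) by (auto simp: \<G>_def)
        then have "u \<in> ball t (k t)" "v \<in> ball t (k t)"
            using tK(1,3,4) atLeastAtMost_iff[of u u v] atLeastAtMost_iff[of v u v] by fastforce+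
        then have "norm (f u - f t - (u - t) *\<^sub>R f' t) \<le> \<eta> * norm (u - t)"
          and "norm (f v - f t - (v - t) *\<^sub>R f' t) \<le> \<eta> * norm (v - t)"
          using k(2)[OF t, of u] k(2)[OF t, of v] tK(2-5) by (auto simp: dist_real_def)
        moreover have "\<delta> p = (f u - f t - (u - t) *\<^sub>R f' t) - (f v - f t - (v - t) *\<^sub>R f' t)"
          using tK tN by (simp add: \<delta>_def p g_def u_def[symmetric] v_def[symmetric] algebra_simps)
        ultimately have "norm (\<delta> p) \<le> \<eta> * norm (u - t) + \<eta> * norm (v - t)"
          using norm_triangle_ineq4 by (smt (verit))
        also have "\<dots> = \<eta> * (v - u)" using tK by (simp add: algebra_simps)
        finally show ?thesis by (simp add: p u_def v_def)
      qed
      have "norm (\<Sum>p\<in>\<D> - \<D>N. \<delta> p) \<le> (\<Sum>p\<in>\<D> - \<D>N. \<eta> * (Sup (snd p) - Inf (snd p)))"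
        by (intro sum_norm_le off)
      also have "\<dots> \<le> (\<Sum>p\<in>\<D>. \<eta> * (Sup (snd p) - Inf (snd p)))"
        using td(1) K \<eta>(1) by (intro sum_mono2) (force intro!: mult_nonneg_nonneg)+
      also have "\<dots> = \<eta> * (b - a)" by (simp add: len sum_distrib_left[symmetric])
      finally have 1: "norm (\<Sum>p\<in>\<D> - \<D>N. \<delta> p) < e / 2" using \<eta>(2) by simp
      have on: "norm (\<delta> p) = norm (f (Sup (snd p)) - f (Inf (snd p)))" if "p \<in> \<D>N" for p
        using that by (simp add: \<delta>_def g_def \<D>N_def norm_minus_commute)
      have finN: "finite \<D>N" using td(1) by (simp add: \<D>N_def)
      have disj: "disjoint_family_on (\<lambda>p. {Inf (snd p)<..<Sup (snd p)}) \<D>N"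
        unfolding disjoint_family_on_def
      proof (intro ballI impI)
        fix p q assume pq: "p \<in> \<D>N" "q \<in> \<D>N" "p \<noteq> q"
        have "interior (snd p) \<inter> interior (snd q) = {}"
          using td(5)[of "fst p" "snd p" "fst q" "snd q"] pq by (auto simp: \<D>N_def prod_eq_iff)
        moreover have "interior (snd s) = {Inf (snd s)<..<Sup (snd s)}" if "s \<in> \<D>N" for s
        proof -
          have "(fst s, snd s) \<in> \<D>" using that by (simp add: \<D>N_def)
          from K_eq[OF this] show ?thesis by (metis interior_atLeastAtMost_real)
        qed
        ultimately show "{Inf (snd p)<..<Sup (snd p)} \<inter> {Inf (snd q)<..<Sup (snd q)} = {}"
          using pq by simp
      qed
      have ordered: "a \<le> Inf (snd p) \<and> Inf (snd p) \<le> Sup (snd p) \<and> Sup (snd p) \<le> b" if "p \<in> \<D>N" for p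
      proof -
        have "(fst p, snd p) \<in> \<D>" using that by (simp add: \<D>N_def)
        from K[OF this] show ?thesis by linarith
      qed
      have "(\<Sum>p\<in>\<D>N. Sup (snd p) - Inf (snd p)) = (\<Sum>p\<in>\<D>N. measure lebesgue {Inf (snd p)<..<Sup (snd p)})"
        using ordered by (intro sum.cong) auto
      also have "\<dots> = measure lebesgue (\<Union>p\<in>\<D>N. {Inf (snd p)<..<Sup (snd p)})"
      proof (rule measure_finite_Union[symmetric, OF finN _ disj])
        show "emeasure lebesgue {Inf (snd p)<..<Sup (snd p)} \<noteq> \<infinity>" if "p \<in> \<D>N" for p
          using emeasure_lborel_Ioo[of "Inf (snd p)" "Sup (snd p)"] ordered[OF that] by simp
      qed auto
      also have "\<dots> \<le> measure lebesgue U"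
      proof (rule measure_mono_fmeasurable)
        show "(\<Union>p\<in>\<D>N. {Inf (snd p)<..<Sup (snd p)}) \<subseteq> U"
        proof (rule UN_least)
          fix p assume "p \<in> \<D>N"
          then have p: "(fst p, snd p) \<in> \<D>" "\<G> (fst p) = U" by (auto simp: \<D>N_def \<G>_def)
          have "{Inf (snd p)<..<Sup (snd p)} \<subseteq> {Inf (snd p)..Sup (snd p)}"
            by (rule greaterThanLessThan_subseteq_atLeastAtMost_iff[THEN iffD2]) simp
          also have "\<dots> = snd p" using K_eq[OF p(1)] by simp
          also have "\<dots> \<subseteq> U" using K(2)[OF p(1)] p(2) by simp
          finally show "{Inf (snd p)<..<Sup (snd p)} \<subseteq> U" .
        qed
      qed (use Um finN in auto)
      finally have "(\<Sum>p\<in>\<D>N. Sup (snd p) - Inf (snd p)) < d" using Um(2) by simp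
      then have "(\<Sum>p\<in>\<D>N. norm (f (Sup (snd p)) - f (Inf (snd p)))) < e / 2"
        by (intro d(2) finN disj ordered)
      then have 2: "norm (\<Sum>p\<in>\<D>N. \<delta> p) < e / 2"
        using norm_sum[of \<delta> \<D>N] on by simp
      have "(\<Sum>(t, K)\<in>\<D>. measure lborel K *\<^sub>R g t) - (f b - f a) = (\<Sum>p\<in>\<D>. \<delta> p)"
        using additive_tagged_division_1[OF \<open>a \<le> b\<close> \<D>(1), of f]
        by (simp add: \<delta>_def sum_subtractf case_prod_beta)
      also have "\<dots> = (\<Sum>p\<in>\<D> - \<D>N. \<delta> p) + (\<Sum>p\<in>\<D>N. \<delta> p)"
        using td(1) by (intro sum.subset_diff) (auto simp: \<D>N_def)
      finally show ?thesis using norm_triangle_ineq 1 2 by (smt (verit) field_sum_of_halves)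
    qed
    show "\<exists>\<gamma>. gauge \<gamma> \<and> (\<forall>\<D>. \<D> tagged_division_of {a..b} \<and> \<gamma> fine \<D> \<longrightarrow>
        norm ((\<Sum>(t, K)\<in>\<D>. measure lborel K *\<^sub>R g t) - (f b - f a)) < e)"
      by (intro exI[of _ \<G>] conjI allI impI gauge small) auto
  qed
  then show ?thesis
    by (rule has_integral_spike[OF N, rotated]) (simp add: g_def)
qed

lemma absolutely_continuous_on_Icc_subinterval:
  assumes "absolutely_continuous_on_Icc a b f" "a \<le> c" "d \<le> b"
  shows "absolutely_continuous_on_Icc c d f"
  unfolding absolutely_continuous_on_Icc_def
proof (intro allI impI)
  fix e :: real assume "e > 0"
  then obtain \<delta> where \<delta>: "\<delta> > 0"
    "\<And>n l r. (\<forall>i<n. a \<le> l i \<and> l i \<le> r i \<and> r i \<le> b) \<and>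
        disjoint_family_on (\<lambda>i. {l i<..<r i}) {..<n::nat} \<and> (\<Sum>i<n. r i - l i) < \<delta> \<Longrightarrow>
        (\<Sum>i<n. norm (f (r i) - f (l i))) < e"
    using assms(1) unfolding absolutely_continuous_on_Icc_def by meson
  show "\<exists>\<delta>>0. \<forall>(n::nat) (l::nat \<Rightarrow> real) (r::nat \<Rightarrow> real).
        (\<forall>i<n. c \<le> l i \<and> l i \<le> r i \<and> r i \<le> d) \<and>
        disjoint_family_on (\<lambda>i. {l i<..<r i}) {..<n} \<and> (\<Sum>i<n. r i - l i) < \<delta> \<longrightarrow>
        (\<Sum>i<n. norm (f (r i) - f (l i))) < e"
    using \<delta> assms(2,3) by (intro exI[of _ \<delta>]) (meson order_trans)
qed

lemma locally_absolutely_continuous_imp_continuous: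
  fixes f :: "real \<Rightarrow> 'a::real_normed_vector"
  assumes "locally_absolutely_continuous f"
  shows "continuous_on {0..} f"
  unfolding continuous_on_iff
proof (intro ballI allI impI)
  fix t e :: real assume t: "t \<in> {0..}" and e: "0 < e"
  have ac: "absolutely_continuous_on_Icc 0 (t + 1) f"
    using assms t by (simp add: locally_absolutely_continuous_def)
  obtain d where d: "0 < d"
    "\<And>(I :: nat set) l r. finite I \<Longrightarrow> (\<And>i. i \<in> I \<Longrightarrow> 0 \<le> l i \<and> l i \<le> r i \<and> r i \<le> t + 1) \<Longrightarrow>
       disjoint_family_on (\<lambda>i. {l i<..<r i}) I \<Longrightarrow> (\<Sum>i\<in>I. r i - l i) < d \<Longrightarrow>
       (\<Sum>i\<in>I. norm (f (r i) - f (l i))) < e"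
    using absolutely_continuous_on_Icc_finite_family[OF ac e, where 'i = nat] by auto
  have "dist (f s) (f t) < e" if s: "0 \<le> s" "dist s t < min d 1" for s
  proof -
    have "norm (f (max s t) - f (min s t)) < e"
    proof -
      have "(\<Sum>i\<in>{0::nat}. norm (f (max s t) - f (min s t))) < e"
        by (rule d(2)) (use s t in \<open>auto simp: dist_real_def disjoint_family_on_def\<close>)
      then show ?thesis by simp
    qed
    then show ?thesis by (cases "s \<le> t") (auto simp: dist_norm norm_minus_commute)
  qed
  then show "\<exists>d>0. \<forall>s\<in>{0..}. dist s t < d \<longrightarrow> dist (f s) (f t) < e"
    using d(1) by (intro exI[of _ "min d 1"]) auto
qed

text \<open>Increments of \<open>f\<close> are integrals of the continuous function \<open>F\<close>, so \<open>F\<close> is the derivative at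
  every point. This turns the differential equation, known almost everywhere, into one that holds
  at all times.\<close>
lemma locally_absolutely_continuous_C1:
  fixes f :: "real \<Rightarrow> 'a::real_normed_vector"
  assumes lac: "locally_absolutely_continuous f"
    and ae: "AE t in lborel. 0 \<le> t \<longrightarrow> (f has_vector_derivative F t) (at t within {0..})"
    and F: "continuous_on {0..} F" and "0 \<le> t"
  shows "(f has_vector_derivative F t) (at t within {0..})"
proof -
  have "AE t in lebesgue. 0 \<le> t \<longrightarrow> (f has_vector_derivative F t) (at t within {0..})"
    using ae by (rule AE_completion)
  then obtain N where N: "N \<in> null_sets lebesgue"
    "\<And>t. 0 \<le> t \<Longrightarrow> t \<notin> N \<Longrightarrow> (f has_vector_derivative F t) (at t within {0..})"
    by (auto elim!: AE_E3)
  have int: "(F has_integral (f s - f r)) {r..s}" if "0 \<le> r" "r \<le> s" for r s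
  proof (rule FTC_absolutely_continuous[OF that(2)])
    have "absolutely_continuous_on_Icc 0 (s + 1) f"
      using lac that by (auto simp: locally_absolutely_continuous_def)
    then show "absolutely_continuous_on_Icc r s f"
      by (rule absolutely_continuous_on_Icc_subinterval) (use that in auto)
    show "negligible N" using N(1) by (simp add: negligible_iff_null_sets)
    show "(f has_vector_derivative F t) (at t within {r..s})" if "t \<in> {r..s} - N" for t
      using N(2)[of t] that \<open>0 \<le> r\<close>
      by (intro has_vector_derivative_within_subset[of f "F t" t "{0..}" "{r..s}"]) auto
  qed
  have bound: "norm (f s - f r - (s - r) *\<^sub>R F t) \<le> e * (s - r)"
    if "0 \<le> r" "r \<le> s" "0 \<le> e" "\<And>q. q \<in> {r..s} \<Longrightarrow> norm (F q - F t) \<le> e" for r s e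
  proof -
    have "((\<lambda>q. F q - F t) has_integral (f s - f r - (s - r) *\<^sub>R F t)) {r..s}"
      using has_integral_diff[OF int[OF that(1,2)] has_integral_const_real[of "F t" r s]] that(2) by simp
    from has_integral_bound_real[OF that(3) finite.emptyI this] that(2,4) show ?thesis by simp
  qed
  show ?thesis
    unfolding has_vector_derivative_def has_derivative_within_alt
  proof (intro conjI allI impI)
    show "bounded_linear (\<lambda>h. h *\<^sub>R F t)" by (rule bounded_linear_scaleR_left)
    fix e :: real assume e: "e > 0"
    then obtain d where d: "d > 0" "\<And>q. 0 \<le> q \<Longrightarrow> dist q t < d \<Longrightarrow> dist (F q) (F t) < e"
      using F \<open>0 \<le> t\<close> unfolding continuous_on_iff by (metis atLeast_iff)
    show "\<exists>d>0. \<forall>y\<in>{0..}. norm (y - t) < d \<longrightarrow> norm (f y - f t - (y - t) *\<^sub>R F t) \<le> e * norm (y - t)"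
    proof (intro exI[of _ d] conjI ballI impI d(1))
      fix y assume y: "y \<in> {0..}" "norm (y - t) < d"
      show "norm (f y - f t - (y - t) *\<^sub>R F t) \<le> e * norm (y - t)"
      proof (cases "t \<le> y")
        case True
        have "norm (F q - F t) \<le> e" if "q \<in> {t..y}" for q
          using d(2)[of q] that y \<open>0 \<le> t\<close> by (auto simp: dist_norm)
        from bound[OF \<open>0 \<le> t\<close> True _ this] show ?thesis using True e by simp
      next
        case False
        have "norm (F q - F t) \<le> e" if "q \<in> {y..t}" for q
          using d(2)[of q] that y \<open>0 \<le> t\<close> by (auto simp: dist_norm)
        from bound[OF _ _ _ this] have "norm (f t - f y - (t - y) *\<^sub>R F t) \<le> e * (t - y)"
          using False e y by simp
        moreover have "f y - f t - (y - t) *\<^sub>R F t = - (f t - f y - (t - y) *\<^sub>R F t)"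
          by (simp add: algebra_simps)
        then have "norm (f y - f t - (y - t) *\<^sub>R F t) = norm (f t - f y - (t - y) *\<^sub>R F t)"
          by (metis norm_minus_cancel)
        ultimately show ?thesis using False by simp
      qed
    qed
  qed
qed

section \<open>Integrals and monotone limits on a half-line\<close>

lemma antimono_bounded_below_tendsto:
  fixes V :: "real \<Rightarrow> real"
  assumes "\<And>s t. a \<le> s \<Longrightarrow> s \<le> t \<Longrightarrow> V t \<le> V s" "\<And>t. a \<le> t \<Longrightarrow> m \<le> V t"
  obtains l where "(V \<longlongrightarrow> l) at_top"
proof
  have bdd: "bdd_below (V ` {a..})" using assms(2) by (auto simp: bdd_below_def)
  show "(V \<longlongrightarrow> Inf (V ` {a..})) at_top"
  proof (rule order_tendstoI)
    fix y assume "y < Inf (V ` {a..})"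
    then have "y < V t" if "a \<le> t" for t
      using cInf_lower[OF _ bdd, of "V t"] that by fastforce
    then show "\<forall>\<^sub>F t in at_top. y < V t"
      by (intro eventually_mono[OF eventually_ge_at_top[of a]]) blast
  next
    fix y assume "Inf (V ` {a..}) < y"
    then obtain s where s: "a \<le> s" "V s < y"
      using cInf_lessD[of "V ` {a..}" y] by auto
    show "\<forall>\<^sub>F t in at_top. V t < y"
      using eventually_ge_at_top[of s] by eventually_elim (use assms(1)[OF s(1)] s(2) in fastforce)
  qed
qed

lemma nonpos_derivative_antimono:
  fixes V :: "real \<Rightarrow> real"
  assumes "\<And>t. a \<le> t \<Longrightarrow> (V has_real_derivative V' t) (at t within {a..})" "\<And>t. a \<le> t \<Longrightarrow> V' t \<le> 0"
    and "a \<le> s" "s \<le> t"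
  shows "V t \<le> V s"
proof (rule DERIV_nonpos_imp_decreasing_open[OF assms(4)])
  fix q assume q: "s < q" "q < t"
  then have "(V has_real_derivative V' q) (at q)"
    using assms(1)[of q] at_within_interior[of q "{a..}"] \<open>a \<le> s\<close> by simp
  then show "\<exists>y. (V has_real_derivative y) (at q) \<and> y \<le> 0" using assms(2)[of q] q \<open>a \<le> s\<close> by auto
next
  have "continuous_on {a..} V"
    using assms(1) by (auto simp: continuous_on_eq_continuous_within intro: DERIV_continuous)
  then show "continuous_on {s..t} V" by (rule continuous_on_subset) (use assms(3) in auto)
qed

lemma integral_has_real_derivative_half_line:
  fixes f :: "real \<Rightarrow> real"
  assumes "continuous_on {a..} f" "a \<le> t"
  shows "((\<lambda>s. integral {a..s} f) has_real_derivative f t) (at t within {a..})"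
proof -
  have "((\<lambda>s. integral {a..s} f) has_real_derivative f t) (at t within {a..t+1})"
    using assms by (intro integral_has_real_derivative continuous_on_subset[OF assms(1)]) auto
  moreover have "at t within {a..t+1} = at t within {a..}"
    by (rule at_within_nhd[of t "{..<t+1}"]) auto
  ultimately show ?thesis by simp
qed

lemma integral_half_line_mono:
  fixes f :: "real \<Rightarrow> real"
  assumes "continuous_on {a..} f" "\<And>t. a \<le> t \<Longrightarrow> 0 \<le> f t" "a \<le> s" "s \<le> t"
  shows "integral {a..s} f \<le> integral {a..t} f"
  using assms
  by (intro integral_subset_le integrable_continuous_real) (auto intro: continuous_on_subset)

lemma set_integrable_half_line:
  fixes f :: "real \<Rightarrow> real"
  assumes cont: "continuous_on {a..} f" and nonneg: "\<And>t. a \<le> t \<Longrightarrow> 0 \<le> f t"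
    and bound: "\<And>t. a \<le> t \<Longrightarrow> integral {a..t} f \<le> U"
  shows "set_integrable lborel {a..} f"
proof -
  define g where "g t = indicator {a..} t * f t" for t
  obtain l where "((\<lambda>t. - integral {a..t} f) \<longlongrightarrow> l) at_top"
  proof (rule antimono_bounded_below_tendsto[of a "\<lambda>t. - integral {a..t} f" "- U"])
    fix s t assume "a \<le> s" "s \<le> t"
    then show "- integral {a..t} f \<le> - integral {a..s} f"
      using integral_half_line_mono[OF cont nonneg] by simp
  qed (use bound in auto)
  then have lim: "((\<lambda>t. integral {a..t} f) \<longlongrightarrow> - l) at_top"
    using tendsto_minus by fastforce
  have restrict: "g t * indicator {..y} t = indicator {a..y} t *\<^sub>R f t" for t y
    by (auto simp: g_def split: split_indicator)
  have int: "set_integrable lborel {a..y} f" for y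
    by (intro borel_integrable_atLeastAtMost' continuous_on_subset[OF cont]) auto
  have "integrable lborel g"
  proof (rule integrable_monotone_convergence_at_top)
    show "AE t in lborel. 0 \<le> g t" using nonneg by (auto simp: g_def split: split_indicator)
    show "g \<in> borel_measurable borel"
      using borel_measurable_continuous_on_indicator[OF _ cont] by (simp add: g_def[abs_def])
    show "integrable lborel (\<lambda>t. g t * indicator {..y} t)" for y
      using int[of y] unfolding restrict set_integrable_def by simp
    have "(\<integral>t. g t * indicator {..y} t \<partial>lborel) = integral {a..y} f" for y
      using set_borel_integral_eq_integral(2)[OF int[of y]]
      unfolding restrict set_lebesgue_integral_def by simp
    then show "((\<lambda>y. \<integral>t. g t * indicator {..y} t \<partial>lborel) \<longlongrightarrow> - l) at_top"
      using lim by simp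
  qed auto
  then show ?thesis by (simp add: set_integrable_def g_def[abs_def])
qed

lemma integral_half_line_le_nn_integral:
  fixes f :: "real \<Rightarrow> real"
  assumes cont: "continuous_on {a..} f" and nonneg: "\<And>t. a \<le> t \<Longrightarrow> 0 \<le> f t"
    and fin: "(\<integral>\<^sup>+ t \<in> {a..}. ennreal (f t) \<partial>lborel) < \<infinity>"
  obtains U where "\<And>t. a \<le> t \<Longrightarrow> integral {a..t} f \<le> U"
proof
  have eq: "ennreal (f t) * indicator {a..} t = ennreal (indicator {a..} t *\<^sub>R f t)" for t
    by (auto split: split_indicator)
  have "set_integrable lborel {a..} f"
    unfolding set_integrable_def
  proof (rule integrableI_nonneg)
    show "(\<lambda>t. indicator {a..} t *\<^sub>R f t) \<in> borel_measurable lborel"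
      using borel_measurable_continuous_on_indicator[OF _ cont] by simp
  qed (use nonneg fin eq in \<open>auto split: split_indicator\<close>)
  then have int: "f integrable_on {a..}" by (rule set_borel_integral_eq_integral)
  show "integral {a..t} f \<le> integral {a..} f" if "a \<le> t" for t
    using nonneg by (intro integral_subset_le int integrable_continuous_real continuous_on_subset[OF cont]) auto
qed

text \<open>The function \<open>W - \<integral>u + \<integral>v\<close> is nonincreasing. The integral bound compares it with its initial
  value; it is also bounded below, so it converges, as do both integrals, being monotone and
  bounded.\<close>
lemma Lyapunov_integral_bound:
  fixes W u v :: "real \<Rightarrow> real"
  assumes deriv: "\<And>t. a \<le> t \<Longrightarrow> (W has_real_derivative W' t) (at t within {a..})"
    and le: "\<And>t. a \<le> t \<Longrightarrow> W' t \<le> u t - v t"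
    and u: "continuous_on {a..} u" "\<And>t. a \<le> t \<Longrightarrow> 0 \<le> u t" "\<And>t. a \<le> t \<Longrightarrow> integral {a..t} u \<le> U"
    and v: "continuous_on {a..} v" "\<And>t. a \<le> t \<Longrightarrow> 0 \<le> v t"
    and below: "\<And>t. a \<le> t \<Longrightarrow> m \<le> W t"
  shows "\<And>t. a \<le> t \<Longrightarrow> integral {a..t} v \<le> W a - m + U" and "\<exists>l. (W \<longlongrightarrow> l) at_top"
proof -
  define V where "V t = W t - integral {a..t} u + integral {a..t} v" for t
  have dV: "(V has_real_derivative (W' t - u t + v t)) (at t within {a..})" if "a \<le> t" for t
    unfolding V_def
    by (intro DERIV_add DERIV_diff deriv integral_has_real_derivative_half_line u(1) v(1) that)
  have V_mono: "V t \<le> V s" if "a \<le> s" "s \<le> t" for s t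
    by (rule nonpos_derivative_antimono[OF dV _ that]) (use le in fastforce)+
  have v_pos: "0 \<le> integral {a..t} v" for t
    by (rule integral_nonneg) (auto intro!: integrable_continuous_real v(2) continuous_on_subset[OF v(1)])
  show bound: "integral {a..t} v \<le> W a - m + U" if "a \<le> t" for t
    using V_mono[OF order_refl that] below[OF that] u(3)[OF that] by (simp add: V_def)
  obtain l1 where l1: "(V \<longlongrightarrow> l1) at_top"
  proof (rule antimono_bounded_below_tendsto[of a V "m - U", OF V_mono])
    fix t assume "a \<le> t"
    then show "m - U \<le> V t" using below[of t] u(3)[of t] v_pos[of t] by (simp add: V_def)
  qed
  obtain l2 where l2: "((\<lambda>t. - integral {a..t} u) \<longlongrightarrow> l2) at_top"
    by (rule antimono_bounded_below_tendsto[of a "\<lambda>t. - integral {a..t} u" "- U"])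
      (use integral_half_line_mono[OF u(1,2)] u(3) in auto)
  obtain l3 where l3: "((\<lambda>t. - integral {a..t} v) \<longlongrightarrow> l3) at_top"
    by (rule antimono_bounded_below_tendsto[of a "\<lambda>t. - integral {a..t} v" "- (W a - m + U)"])
      (use integral_half_line_mono[OF v] bound in \<open>force simp: algebra_simps\<close>)+
  have "((\<lambda>t. V t - (- integral {a..t} u) + (- integral {a..t} v)) \<longlongrightarrow> l1 - l2 + l3) at_top"
    by (intro tendsto_intros l1 l2 l3)
  then show "\<exists>l. (W \<longlongrightarrow> l) at_top" by (auto simp: V_def)
qed

section \<open>Energy estimates for the penalised inertial dynamics\<close>

lemma GDERIV_half_square_dist: "GDERIV (\<lambda>y. (norm (y - z))\<^sup>2 / 2) y :> y - z"
  unfolding gderiv_def power2_norm_eq_inner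
  by (auto intro!: derivative_eq_intros simp: inner_commute)

text \<open>Classical solutions of the equation, written as a first-order system for position and
  velocity.\<close>
locale penalised_dynamics =
  fixes \<phi> \<psi> :: "'a::{real_inner, complete_space} \<Rightarrow> real"
    and \<beta> \<beta>' :: "real \<Rightarrow> real"
    and \<gamma> k :: real
    and x v :: "real \<Rightarrow> 'a"
  assumes gamma: "0 < \<gamma>"
    and psi_nonneg: "\<And>z. 0 \<le> \<psi> z"
    and psi_convex: "convex_on UNIV \<psi>"
    and psi_diff: "\<And>z. \<psi> differentiable (at z)"
    and psi_argmin: "argmin \<psi> = \<psi> -` {0}"
    and phi_convex: "convex_on UNIV \<phi>"
    and phi_diff: "\<And>z. \<phi> differentiable (at z)"
    and phi_bdd: "bdd_below (range \<phi>)"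
    and beta_pos: "\<And>t. 0 \<le> t \<Longrightarrow> 0 < \<beta> t"
    and beta_deriv: "\<And>t. 0 \<le> t \<Longrightarrow> (\<beta> has_real_derivative \<beta>' t) (at t within {0..})"
    and k: "0 \<le> k" "k < \<gamma>"
    and beta_growth: "\<And>t. 0 \<le> t \<Longrightarrow> \<beta>' t \<le> k * \<beta> t"
    and H: "\<And>p. p \<in> ran_normal_cone (argmin \<psi>) \<Longrightarrow>
          (\<integral>\<^sup>+ t \<in> {0..}. e2ennreal (ereal (\<beta> t) *
             (fenchel_conjugate \<psi> (p /\<^sub>R \<beta> t) - support_function (argmin \<psi>) (p /\<^sub>R \<beta> t)))
           \<partial>lborel) < \<infinity>"
    and beta_lim: "filterlim \<beta> at_top at_top"
    and x_deriv: "\<And>t. 0 \<le> t \<Longrightarrow> (x has_vector_derivative v t) (at t within {0..})"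
    and v_deriv: "\<And>t. 0 \<le> t \<Longrightarrow> (v has_vector_derivative
          - (\<gamma> *\<^sub>R v t) - gradient \<phi> (x t) - \<beta> t *\<^sub>R gradient \<psi> (x t)) (at t within {0..})"
begin

lemma GDERIV_phi: "GDERIV \<phi> z :> gradient \<phi> z" by (rule GDERIV_gradient[OF phi_diff])
lemma GDERIV_psi: "GDERIV \<psi> z :> gradient \<psi> z" by (rule GDERIV_gradient[OF psi_diff])

abbreviation C where "C \<equiv> argmin \<psi>"
abbreviation S where "S \<equiv> argmin_on C \<phi>"

lemma C_iff: "z \<in> C \<longleftrightarrow> \<psi> z = 0" using psi_argmin by auto

lemma S_iff: "z \<in> S \<longleftrightarrow> \<psi> z = 0 \<and> (\<forall>y. \<psi> y = 0 \<longrightarrow> \<phi> z \<le> \<phi> y)"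
  unfolding argmin_on_def[of C] is_arg_min_def C_iff by (auto simp: not_less)

lemma convex_C: "convex C"
proof -
  have "\<psi> ((1 - u) *\<^sub>R y + u *\<^sub>R z) = 0" if "\<psi> y = 0" "\<psi> z = 0" "0 \<le> u" "u \<le> 1" for y z u
    using convex_onD[OF psi_convex, of u y z] that psi_nonneg[of "(1 - u) *\<^sub>R y + u *\<^sub>R z"] by simp
  then show ?thesis unfolding convex_alt Ball_def C_iff by blast
qed

lemma minus_gradient_normal:
  assumes "z \<in> S" "0 \<le> r"
  shows "r *\<^sub>R (- gradient \<phi> z) \<in> normal_cone C z"
proof -
  have z: "z \<in> C" "\<And>y. y \<in> C \<Longrightarrow> \<phi> z \<le> \<phi> y" using assms(1) by (auto simp: S_iff C_iff)
  have "0 \<le> inner (gradient \<phi> z) (y - z)" if "y \<in> C" for y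
    by (rule minimizer_variational_inequality[OF convex_C z GDERIV_phi that])
  then show ?thesis using z(1) assms(2) by (simp add: normal_cone_def)
qed

lemma continuous_x: "continuous_on {0..} x"
  using x_deriv by (auto simp: continuous_on_eq_continuous_within intro: has_vector_derivative_continuous)

lemma continuous_v: "continuous_on {0..} v"
  using v_deriv by (auto simp: continuous_on_eq_continuous_within intro: has_vector_derivative_continuous)

lemma continuous_beta: "continuous_on {0..} \<beta>"
  using beta_deriv by (auto simp: continuous_on_eq_continuous_within intro: DERIV_continuous)

lemma continuous_psi_x: "continuous_on {0..} (\<lambda>t. \<psi> (x t))"
  using has_real_derivative_along_curve[OF GDERIV_psi x_deriv]
  by (auto simp: continuous_on_eq_continuous_within intro: DERIV_continuous)

text \<open>As \<open>q\<close> is normal to \<open>C\<close> at \<open>z\<close>, the support function of \<open>C\<close> at \<open>q/\<beta>\<close> is at most \<open>\<langle>q/\<beta>, z\<rangle>\<close>,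
  while \<open>\<psi>\<^sup>*(q/\<beta>)\<close> is at least \<open>\<langle>q/\<beta>, x\<rangle> - \<psi>(x)\<close>. So the integrand of \<open>H\<close> dominates the amount
  by which the linear term \<open>\<langle>q, x - z\<rangle>\<close> exceeds the penalty. Taking the positive part matches the
  truncation at \<open>0\<close> performed by \<^const>\<open>e2ennreal\<close>.\<close>
lemma penalty_excess_integral_bounded:
  assumes q: "q \<in> normal_cone C z"
  obtains U where
    "\<And>t. 0 \<le> t \<Longrightarrow> integral {0..t} (\<lambda>s. max 0 (inner q (x s - z) - \<beta> s * \<psi> (x s))) \<le> U"
proof -
  have "q \<in> ran_normal_cone C" using q by (auto simp: ran_normal_cone_def)
  note fin = H[OF this]
  have "ennreal (max 0 (inner q (x t - z) - \<beta> t * \<psi> (x t))) \<le> e2ennreal (ereal (\<beta> t) *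
      (fenchel_conjugate \<psi> (q /\<^sub>R \<beta> t) - support_function C (q /\<^sub>R \<beta> t)))" if t: "0 \<le> t" for t
  proof -
    define b where "b = \<beta> t"
    have b: "b > 0" using beta_pos t by (simp add: b_def)
    have "inner (q /\<^sub>R b) y \<le> inner (q /\<^sub>R b) z" if "y \<in> C" for y
      using q b that by (auto simp: normal_cone_def inner_diff_right split: if_splits)
    then have "support_function C (q /\<^sub>R b) \<le> ereal (inner (q /\<^sub>R b) z)"
      unfolding support_function_def by (intro SUP_least) simp
    moreover have "ereal (inner (q /\<^sub>R b) (x t) - \<psi> (x t)) \<le> fenchel_conjugate \<psi> (q /\<^sub>R b)"
      unfolding fenchel_conjugate_def by (rule SUP_upper) simp
    ultimately have "ereal (inner (q /\<^sub>R b) (x t) - \<psi> (x t)) - ereal (inner (q /\<^sub>R b) z)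
        \<le> fenchel_conjugate \<psi> (q /\<^sub>R b) - support_function C (q /\<^sub>R b)"
      by (rule ereal_minus_mono[rotated])
    then have "ereal b * (ereal (inner (q /\<^sub>R b) (x t) - \<psi> (x t)) - ereal (inner (q /\<^sub>R b) z))
        \<le> ereal b * (fenchel_conjugate \<psi> (q /\<^sub>R b) - support_function C (q /\<^sub>R b))"
      using b by (intro ereal_mult_left_mono) auto
    also have "ereal b * (ereal (inner (q /\<^sub>R b) (x t) - \<psi> (x t)) - ereal (inner (q /\<^sub>R b) z))
        = ereal (inner q (x t - z) - b * \<psi> (x t))"
      using b by (simp add: inner_diff_right field_simps)
    finally have "e2ennreal (ereal (inner q (x t - z) - b * \<psi> (x t)))
        \<le> e2ennreal (ereal b * (fenchel_conjugate \<psi> (q /\<^sub>R b) - support_function C (q /\<^sub>R b)))"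
      by (rule e2ennreal_mono)
    then show ?thesis by (simp add: b_def ennreal_max_0)
  qed
  then have "(\<integral>\<^sup>+ t \<in> {0..}. ennreal (max 0 (inner q (x t - z) - \<beta> t * \<psi> (x t))) \<partial>lborel)
    \<le> (\<integral>\<^sup>+ t \<in> {0..}. e2ennreal (ereal (\<beta> t) *
      (fenchel_conjugate \<psi> (q /\<^sub>R \<beta> t) - support_function C (q /\<^sub>R \<beta> t))) \<partial>lborel)"
    by (intro nn_integral_mono) (auto split: split_indicator)
  then have "(\<integral>\<^sup>+ t \<in> {0..}. ennreal (max 0 (inner q (x t - z) - \<beta> t * \<psi> (x t))) \<partial>lborel) < \<infinity>"
    using fin by (rule le_less_trans)
  then show thesis
    by (rule integral_half_line_le_nn_integral[rotated 2])
      (auto intro!: continuous_intros continuous_x continuous_beta continuous_psi_x that)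
qed

definition energy where
  "energy t = (norm (v t))\<^sup>2 / 2 + \<phi> (x t) + \<beta> t * \<psi> (x t)"

text \<open>This is \<open>h' + \<gamma> h\<close> for \<open>h = \<parallel>x - z\<parallel>\<^sup>2/2\<close>; in this combination the friction term of \<open>h''\<close>
  cancels.\<close>
definition anchor where
  "anchor z t = inner (x t - z) (v t) + \<gamma> * (norm (x t - z))\<^sup>2 / 2"

lemma energy_deriv:
  assumes t: "0 \<le> t"
  shows "(energy has_real_derivative \<beta>' t * \<psi> (x t) - \<gamma> * (norm (v t))\<^sup>2) (at t within {0..})"
proof -
  have "((\<lambda>t. (norm (v t))\<^sup>2 / 2) has_real_derivative
      inner (v t) (- (\<gamma> *\<^sub>R v t) - gradient \<phi> (x t) - \<beta> t *\<^sub>R gradient \<psi> (x t))) (at t within {0..})"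
    using has_real_derivative_along_curve[OF GDERIV_half_square_dist[of 0] v_deriv[OF t]] by simp
  moreover note has_real_derivative_along_curve[OF GDERIV_phi x_deriv[OF t]]
  moreover note DERIV_mult[OF beta_deriv[OF t] has_real_derivative_along_curve[OF GDERIV_psi x_deriv[OF t]]]
  ultimately have "((\<lambda>t. (norm (v t))\<^sup>2 / 2 + \<phi> (x t) + \<beta> t * \<psi> (x t)) has_real_derivative
      inner (v t) (- (\<gamma> *\<^sub>R v t) - gradient \<phi> (x t) - \<beta> t *\<^sub>R gradient \<psi> (x t))
      + inner (gradient \<phi> (x t)) (v t)
      + (\<beta>' t * \<psi> (x t) + inner (gradient \<psi> (x t)) (v t) * \<beta> t)) (at t within {0..})"
    by (intro DERIV_add)
  then show ?thesis unfolding energy_def[abs_def]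
    by (rule DERIV_cong)
      (simp add: inner_diff_right inner_commute[of "v t" "gradient _ _"] power2_norm_eq_inner)
qed

lemma anchor_deriv:
  assumes t: "0 \<le> t"
  shows "(anchor z has_real_derivative (norm (v t))\<^sup>2
      - inner (x t - z) (gradient \<phi> (x t)) - \<beta> t * inner (x t - z) (gradient \<psi> (x t))) (at t within {0..})"
proof -
  have "((\<lambda>t. x t - z) has_vector_derivative v t) (at t within {0..})"
    using x_deriv[OF t] by (auto intro!: derivative_eq_intros)
  from bounded_bilinear.has_vector_derivative[OF bounded_bilinear_inner this v_deriv[OF t]]
  have "((\<lambda>t. inner (x t - z) (v t)) has_real_derivative
      inner (x t - z) (- (\<gamma> *\<^sub>R v t) - gradient \<phi> (x t) - \<beta> t *\<^sub>R gradient \<psi> (x t))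
      + inner (v t) (v t)) (at t within {0..})"
    by (simp add: has_real_derivative_iff_has_vector_derivative)
  moreover have "((\<lambda>t. \<gamma> * ((norm (x t - z))\<^sup>2 / 2)) has_real_derivative
      \<gamma> * inner (x t - z) (v t)) (at t within {0..})"
    by (intro DERIV_cmult has_real_derivative_along_curve[OF GDERIV_half_square_dist x_deriv] t)
  ultimately have "((\<lambda>t. inner (x t - z) (v t) + \<gamma> * ((norm (x t - z))\<^sup>2 / 2)) has_real_derivative
      inner (x t - z) (- (\<gamma> *\<^sub>R v t) - gradient \<phi> (x t) - \<beta> t *\<^sub>R gradient \<psi> (x t))
      + inner (v t) (v t) + \<gamma> * inner (x t - z) (v t)) (at t within {0..})"
    by (intro DERIV_add)
  then have "((\<lambda>t. inner (x t - z) (v t) + \<gamma> * ((norm (x t - z))\<^sup>2 / 2)) has_real_derivative (norm (v t))\<^sup>2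
      - inner (x t - z) (gradient \<phi> (x t)) - \<beta> t * inner (x t - z) (gradient \<psi> (x t))) (at t within {0..})"
    by (rule DERIV_cong) (simp add: inner_diff_right[of "x t - z"] power2_norm_eq_inner)
  then show ?thesis by (simp add: anchor_def[abs_def])
qed

lemma penalty_gradient_ge:
  assumes "z \<in> C" "0 \<le> t"
  shows "\<beta> t * \<psi> (x t) \<le> \<beta> t * inner (x t - z) (gradient \<psi> (x t))"
proof -
  have "\<psi> (x t) \<le> inner (x t - z) (gradient \<psi> (x t))"
    using convex_GDERIV_below[OF psi_convex GDERIV_psi, of "x t" z] assms(1)
    by (simp add: C_iff inner_diff inner_commute)
  then show ?thesis using beta_pos[OF assms(2)] by simp
qed

lemma objective_gradient_ge: "\<phi> (x t) - \<phi> z \<le> inner (x t - z) (gradient \<phi> (x t))"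
  using convex_GDERIV_below[OF phi_convex GDERIV_phi, of "x t" z]
  by (simp add: inner_diff inner_commute)

lemma penalty_nonneg: "0 \<le> t \<Longrightarrow> 0 \<le> \<beta> t * \<psi> (x t)"
  using beta_pos[of t] psi_nonneg[of "x t"] by simp

definition \<mu> where "\<mu> = Inf (range \<phi>)"

lemma mu_le: "\<mu> \<le> \<phi> y"
  unfolding \<mu>_def by (rule cInf_lower) (use phi_bdd in auto)

text \<open>In the derivative of \<open>anchor + c * energy\<close>, the kinetic term has the coefficient \<open>1 - c \<gamma>\<close> and
  the penalty term at most \<open>c k - 1\<close>. These constants make both of them equal to \<open>-\<delta>\<close>.\<close>
definition c where "c = 2 / (\<gamma> + k)"
definition \<delta> where "\<delta> = (\<gamma> - k) / (\<gamma> + k)"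

lemma c_pos: "0 < c" and delta_pos: "0 < \<delta>" and c_gamma: "c * \<gamma> = 1 + \<delta>" and c_k: "c * k = 1 - \<delta>"
  using gamma k by (auto simp: c_def \<delta>_def field_simps)

definition Lyapunov where "Lyapunov z t = anchor z t + c * energy t"

text \<open>The indefinite term \<open>\<langle>x - z, v\<rangle>\<close> is absorbed by completing the square
  \<open>\<parallel>(x - z) + c v\<parallel>\<^sup>2 / (2 c)\<close>. This costs \<open>1/(2 c) = (\<gamma> + k)/4\<close> of the coefficient \<open>\<gamma>/2\<close> of
  \<open>\<parallel>x - z\<parallel>\<^sup>2\<close>, so \<open>(\<gamma> - k)/4\<close> is left. The bound keeps \<open>W\<close> bounded below and later makes the
  trajectory bounded.\<close>
lemma Lyapunov_ge:
  assumes "0 \<le> t"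
  shows "c * \<mu> + (\<gamma> - k) / 4 * (norm (x t - z))\<^sup>2 \<le> Lyapunov z t"
proof -
  have c2: "1 / (2 * c) = (\<gamma> + k) / 4" using gamma k by (simp add: c_def)
  have "0 \<le> (norm ((x t - z) + c *\<^sub>R v t))\<^sup>2" by simp
  also have "\<dots> = 2 * c * (1 / (2 * c) * (norm (x t - z))\<^sup>2 + inner (x t - z) (v t) + c * (norm (v t))\<^sup>2 / 2)"
    using c_pos unfolding power2_norm_eq_inner inner_add_left inner_add_right
    by (simp add: inner_commute power2_eq_square field_simps)
  finally have "0 \<le> 1 / (2 * c) * (norm (x t - z))\<^sup>2 + inner (x t - z) (v t) + c * (norm (v t))\<^sup>2 / 2"
    using c_pos by (simp add: zero_le_mult_iff)
  then have 1: "0 \<le> (\<gamma> + k) / 4 * (norm (x t - z))\<^sup>2 + inner (x t - z) (v t) + c * (norm (v t))\<^sup>2 / 2"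
    unfolding c2 .
  have "c * (\<mu> + (norm (v t))\<^sup>2 / 2) \<le> c * energy t"
    using mu_le[of "x t"] penalty_nonneg[OF assms] c_pos by (simp add: energy_def)
  with 1 show ?thesis
    by (simp add: Lyapunov_def anchor_def algebra_simps add_divide_distrib diff_divide_distrib)
qed

text \<open>The derivative of \<open>Lyapunov z\<close> is at most
  \<open>- \<delta> \<parallel>v\<parallel>\<^sup>2 - \<delta> \<beta> \<psi>(x) - \<langle>\<nabla>\<phi>(z), x - z\<rangle>\<close>. The last term is rewritten as
  \<open>\<delta>/2 \<langle>q, x - z\<rangle>\<close> with \<open>q = - 2/\<delta> \<nabla>\<phi>(z)\<close>, again a normal vector; half of the penalty
  dissipation turns it into the positive part \<open>g\<close>, which has bounded integrals. What remains is the
  dissipation \<open>D\<close>.\<close>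
lemma
  assumes z: "z \<in> S"
  shows Lyapunov_convergent: "\<exists>l. (Lyapunov z \<longlongrightarrow> l) at_top"
    and dissipation_integral_bounded: "\<exists>B. \<forall>t\<ge>0.
      integral {0..t} (\<lambda>t. (norm (v t))\<^sup>2) \<le> B \<and> integral {0..t} (\<lambda>t. \<beta> t * \<psi> (x t)) \<le> B"
proof -
  define q where "q = (2 / \<delta>) *\<^sub>R (- gradient \<phi> z)"
  define g where "g t = max 0 (inner q (x t - z) - \<beta> t * \<psi> (x t))" for t
  have "q \<in> normal_cone C z"
    unfolding q_def by (rule minus_gradient_normal[OF z]) (use delta_pos in simp)
  then obtain U where
    "\<And>t. 0 \<le> t \<Longrightarrow> integral {0..t} (\<lambda>s. max 0 (inner q (x s - z) - \<beta> s * \<psi> (x s))) \<le> U"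
    using penalty_excess_integral_bounded by blast
  then have U: "\<And>t. 0 \<le> t \<Longrightarrow> integral {0..t} g \<le> U"
    unfolding g_def[abs_def] .
  define D where "D t = \<delta> * (norm (v t))\<^sup>2 + \<delta> / 2 * (\<beta> t * \<psi> (x t))" for t
  define W' where "W' t = (norm (v t))\<^sup>2 - inner (x t - z) (gradient \<phi> (x t))
      - \<beta> t * inner (x t - z) (gradient \<psi> (x t)) + c * (\<beta>' t * \<psi> (x t) - \<gamma> * (norm (v t))\<^sup>2)" for t
  have zC: "z \<in> C" using z by (simp add: S_iff C_iff)
  have deriv: "(Lyapunov z has_real_derivative W' t) (at t within {0..})" if "0 \<le> t" for t
    unfolding Lyapunov_def[abs_def] W'_def by (intro DERIV_add DERIV_cmult anchor_deriv energy_deriv that)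
  have le: "W' t \<le> \<delta> / 2 * g t - D t" if t: "0 \<le> t" for t
  proof -
    have "\<beta>' t * \<psi> (x t) \<le> k * \<beta> t * \<psi> (x t)"
      by (rule mult_right_mono[OF beta_growth[OF t] psi_nonneg])
    then have "c * (\<beta>' t * \<psi> (x t) - \<gamma> * (norm (v t))\<^sup>2)
        \<le> c * (k * \<beta> t * \<psi> (x t) - \<gamma> * (norm (v t))\<^sup>2)"
      using c_pos by simp
    also have "\<dots> = (c * k) * (\<beta> t * \<psi> (x t)) - (c * \<gamma>) * (norm (v t))\<^sup>2"
      by (simp add: algebra_simps)
    also have "\<dots> = (1 - \<delta>) * (\<beta> t * \<psi> (x t)) - (1 + \<delta>) * (norm (v t))\<^sup>2"
      by (simp only: c_k c_gamma)
    finally have 1: "c * (\<beta>' t * \<psi> (x t) - \<gamma> * (norm (v t))\<^sup>2)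
        \<le> (1 - \<delta>) * (\<beta> t * \<psi> (x t)) - (1 + \<delta>) * (norm (v t))\<^sup>2" .
    have "\<delta> / 2 * (inner q (x t - z) - \<beta> t * \<psi> (x t)) \<le> \<delta> / 2 * g t"
      using delta_pos by (intro mult_left_mono) (auto simp: g_def)
    moreover have "\<delta> / 2 * (inner q (x t - z) - \<beta> t * \<psi> (x t))
        = - inner (gradient \<phi> z) (x t - z) - \<delta> / 2 * (\<beta> t * \<psi> (x t))"
      using delta_pos by (simp add: q_def algebra_simps)
    moreover have "inner (gradient \<phi> z) (x t - z) \<le> inner (x t - z) (gradient \<phi> (x t))"
      using convex_GDERIV_below[OF phi_convex GDERIV_phi, of z "x t"] objective_gradient_ge[of t z] by simp
    ultimately show ?thesis
      using 1 penalty_gradient_ge[OF zC t] unfolding W'_def D_def by (simp add: algebra_simps)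
  qed
  have contg: "continuous_on {0..} g"
    unfolding g_def[abs_def] by (intro continuous_intros continuous_x continuous_beta continuous_psi_x)
  have contD: "continuous_on {0..} D" unfolding D_def[abs_def]
    by (intro continuous_intros continuous_v continuous_beta continuous_psi_x)
  have D_nonneg: "0 \<le> D t" if "0 \<le> t" for t
    using penalty_nonneg[OF that] delta_pos by (simp add: D_def)
  have below: "c * \<mu> \<le> Lyapunov z t" if "0 \<le> t" for t
  proof -
    have "0 \<le> (\<gamma> - k) / 4 * (norm (x t - z))\<^sup>2" using k by simp
    then show ?thesis using Lyapunov_ge[OF that, of z] by linarith
  qed
  note L = Lyapunov_integral_bound[where u = "\<lambda>t. \<delta> / 2 * g t" and U = "\<delta> / 2 * U", OF deriv le
     continuous_on_mult_left[OF contg] _ _ contD D_nonneg below]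
  have u: "0 \<le> \<delta> / 2 * g t" "0 \<le> t \<Longrightarrow> integral {0..t} (\<lambda>t. \<delta> / 2 * g t) \<le> \<delta> / 2 * U" for t
  proof -
    show "0 \<le> \<delta> / 2 * g t" using delta_pos by (simp add: g_def)
    show "integral {0..t} (\<lambda>t. \<delta> / 2 * g t) \<le> \<delta> / 2 * U" if "0 \<le> t"
      using delta_pos U[OF that] by simp
  qed
  show "\<exists>l. (Lyapunov z \<longlongrightarrow> l) at_top" by (rule L(2)) (use u in auto)
  define M where "M = Lyapunov z 0 - c * \<mu> + \<delta> / 2 * U"
  have M: "integral {0..t} D \<le> M" if "0 \<le> t" for t
    unfolding M_def by (rule L(1)) (use u that in auto)
  have part: "integral {0..t} f \<le> 2 / \<delta> * M"
    if t: "0 \<le> t" and f: "continuous_on {0..} f" "\<And>s. 0 \<le> s \<Longrightarrow> \<delta> / 2 * f s \<le> D s" for t f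
  proof -
    have "\<delta> / 2 * integral {0..t} f = integral {0..t} (\<lambda>s. \<delta> / 2 * f s)" by simp
    also have "\<dots> \<le> integral {0..t} D"
      using f by (intro integral_le integrable_continuous_real continuous_intros
          continuous_on_subset[OF f(1)] continuous_on_subset[OF contD]) auto
    also have "\<dots> \<le> M" by (rule M[OF t])
    finally show ?thesis using delta_pos by (simp add: field_simps)
  qed
  show "\<exists>B. \<forall>t\<ge>0. integral {0..t} (\<lambda>t. (norm (v t))\<^sup>2) \<le> B \<and> integral {0..t} (\<lambda>t. \<beta> t * \<psi> (x t)) \<le> B"
  proof (intro exI[of _ "2 / \<delta> * M"] allI impI conjI part)
    fix s :: real assume s: "0 \<le> s"
    show "\<delta> / 2 * (norm (v s))\<^sup>2 \<le> D s"
      using penalty_nonneg[OF s] delta_pos by (simp add: D_def add_increasing2)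
    show "\<delta> / 2 * (\<beta> s * \<psi> (x s)) \<le> D s" using delta_pos by (simp add: D_def)
  qed (intro continuous_intros continuous_v continuous_beta continuous_psi_x | assumption)+
qed

text \<open>The energy may increase, but only at the rate \<open>k \<beta> \<psi>(x)\<close>, whose integral is now known to be
  bounded.\<close>
lemma energy_convergent:
  assumes z: "z \<in> S"
  shows "\<exists>e. (energy \<longlongrightarrow> e) at_top"
proof -
  obtain B where B: "\<And>t. 0 \<le> t \<Longrightarrow> integral {0..t} (\<lambda>t. \<beta> t * \<psi> (x t)) \<le> B"
    using dissipation_integral_bounded[OF z] by blast
  show ?thesis
  proof (rule Lyapunov_integral_bound(2)[where u = "\<lambda>t. k * (\<beta> t * \<psi> (x t))" and v = "\<lambda>t. 0"
        and U = "k * B" and m = \<mu>, OF energy_deriv])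
    fix t :: real assume t: "0 \<le> t"
    have "\<beta>' t * \<psi> (x t) \<le> k * \<beta> t * \<psi> (x t)"
      by (rule mult_right_mono[OF beta_growth[OF t] psi_nonneg])
    then show "\<beta>' t * \<psi> (x t) - \<gamma> * (norm (v t))\<^sup>2 \<le> k * (\<beta> t * \<psi> (x t)) - 0"
      using gamma by (simp add: algebra_simps add_increasing2)
    show "0 \<le> k * (\<beta> t * \<psi> (x t))" using penalty_nonneg[OF t] k(1) by simp
    show "integral {0..t} (\<lambda>t. k * (\<beta> t * \<psi> (x t))) \<le> k * B"
      using B[OF t] k(1) by (simp add: mult_left_mono)
    show "\<mu> \<le> energy t"
      using mu_le[of "x t"] penalty_nonneg[OF t] by (simp add: energy_def add_increasing add_increasing2)
  qed (auto intro!: continuous_intros continuous_beta continuous_psi_x)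
qed

text \<open>The derivative of \<open>anchor z\<close> is at most \<open>3/2 \<parallel>v\<parallel>\<^sup>2 - (energy - \<phi>(z))\<close>. If the energy stayed above
  \<open>\<phi>(z) + \<eta>\<close>, the integrability of \<open>\<parallel>v\<parallel>\<^sup>2\<close> would send the anchor to \<open>-\<infinity>\<close>, although it equals
  \<open>Lyapunov z - c * energy\<close> and converges.\<close>
lemma energy_limit_le:
  assumes z: "z \<in> S" and e: "(energy \<longlongrightarrow> e) at_top"
  shows "e \<le> \<phi> z"
proof (rule ccontr)
  assume "\<not> e \<le> \<phi> z"
  define \<eta> where "\<eta> = (e - \<phi> z) / 2"
  have \<eta>: "0 < \<eta>" "\<phi> z + \<eta> < e" using \<open>\<not> e \<le> \<phi> z\<close> by (auto simp: \<eta>_def field_simps)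
  obtain l where "(Lyapunov z \<longlongrightarrow> l) at_top" using Lyapunov_convergent[OF z] by blast
  then have "((\<lambda>t. Lyapunov z t - c * energy t) \<longlongrightarrow> l - c * e) at_top"
    by (intro tendsto_intros e)
  then have "(anchor z \<longlongrightarrow> l - c * e) at_top" by (simp add: Lyapunov_def)
  then have "\<forall>\<^sub>F t in at_top. l - c * e - 1 < anchor z t" by (rule order_tendstoD) simp
  moreover have "\<forall>\<^sub>F t in at_top. \<phi> z + \<eta> < energy t" by (rule order_tendstoD(1)[OF e \<eta>(2)])
  ultimately have "\<forall>\<^sub>F t in at_top. l - c * e - 1 < anchor z t \<and> \<phi> z + \<eta> < energy t \<and> 0 \<le> t"
    using eventually_ge_at_top[of 0] by eventually_elim simp
  then obtain T where T: "\<And>t. T \<le> t \<Longrightarrow> l - c * e - 1 < anchor z t \<and> \<phi> z + \<eta> < energy t \<and> 0 \<le> t"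
    unfolding eventually_at_top_linorder by blast
  obtain B where B: "\<And>t. 0 \<le> t \<Longrightarrow> integral {0..t} (\<lambda>t. (norm (v t))\<^sup>2) \<le> B"
    using dissipation_integral_bounded[OF z] by blast
  have contv: "continuous_on {0..} (\<lambda>t. (norm (v t))\<^sup>2)" by (intro continuous_intros continuous_v)
  have T0: "0 \<le> T" using T by blast
  then have contT: "continuous_on {T..} (\<lambda>t. 3 / 2 * (norm (v t))\<^sup>2)"
    by (intro continuous_intros continuous_on_subset[OF continuous_v]) auto
  have bound: "integral {T..t} (\<lambda>_. \<eta>) \<le> anchor z T - (l - c * e - 1) + 3 / 2 * B" if "T \<le> t" for t
  proof (rule Lyapunov_integral_bound(1)[where u = "\<lambda>t. 3 / 2 * (norm (v t))\<^sup>2" and a = T])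
    fix s assume "T \<le> s"
    then have s: "0 \<le> s" "{T..} \<subseteq> {0..}" using T0 by auto
    show "(anchor z has_real_derivative (norm (v s))\<^sup>2 - inner (x s - z) (gradient \<phi> (x s))
        - \<beta> s * inner (x s - z) (gradient \<psi> (x s))) (at s within {T..})"
      by (rule DERIV_subset[OF anchor_deriv[OF s(1)] s(2)])
    have "z \<in> C" using z by (simp add: S_iff C_iff)
    then show "(norm (v s))\<^sup>2 - inner (x s - z) (gradient \<phi> (x s))
        - \<beta> s * inner (x s - z) (gradient \<psi> (x s)) \<le> 3 / 2 * (norm (v s))\<^sup>2 - \<eta>"
      using objective_gradient_ge[of s z] penalty_gradient_ge[OF _ s(1), of z] T[OF \<open>T \<le> s\<close>]
      by (simp add: energy_def)
    have "integral {T..s} (\<lambda>t. (norm (v t))\<^sup>2) \<le> integral {0..s} (\<lambda>t. (norm (v t))\<^sup>2)"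
      using T0 by (intro integral_subset_le integrable_continuous_real continuous_on_subset[OF contv]) auto
    then show "integral {T..s} (\<lambda>t. 3 / 2 * (norm (v t))\<^sup>2) \<le> 3 / 2 * B"
      using B[OF s(1)] by simp
    show "l - c * e - 1 \<le> anchor z s" using T[OF \<open>T \<le> s\<close>] by simp
  qed (use \<eta> that contT in auto)
  define K where "K = anchor z T - (l - c * e - 1) + 3 / 2 * B"
  have "\<eta> * r \<le> K" if "0 \<le> r" for r
    using bound[of "T + r"] that by (simp add: K_def mult.commute)
  from this[of "(\<bar>K\<bar> + 1) / \<eta>"] show False using \<eta>(1) by simp
qed

lemma trajectory_bounded:
  assumes z: "z \<in> S"
  obtains B where "\<forall>\<^sub>F t in at_top. norm (x t - z) \<le> B"
proof -
  obtain l where "(Lyapunov z \<longlongrightarrow> l) at_top" using Lyapunov_convergent[OF z] by blast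
  then have "\<forall>\<^sub>F t in at_top. Lyapunov z t < l + 1" by (rule order_tendstoD) simp
  then have "\<forall>\<^sub>F t in at_top. norm (x t - z) \<le> sqrt ((l + 1 - c * \<mu>) / ((\<gamma> - k) / 4))"
    using eventually_ge_at_top[of 0]
  proof eventually_elim
    case (elim t)
    then have "(\<gamma> - k) / 4 * (norm (x t - z))\<^sup>2 \<le> l + 1 - c * \<mu>" using Lyapunov_ge[of t z] by simp
    then have "(norm (x t - z))\<^sup>2 \<le> (l + 1 - c * \<mu>) / ((\<gamma> - k) / 4)"
      using k by (simp add: field_simps)
    then show ?case by (rule real_le_rsqrt)
  qed
  then show thesis by (rule that)
qed

text \<open>Bounded energy gives \<open>\<psi>(x) = O(1/\<beta>)\<close>; the stronger statement about \<open>\<beta> \<psi>(x)\<close> needs the limit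
  of the energy.\<close>
lemma penalty_value_tendsto_0:
  assumes z: "z \<in> S"
  shows "((\<lambda>t. \<psi> (x t)) \<longlongrightarrow> 0) at_top"
proof -
  obtain e where "(energy \<longlongrightarrow> e) at_top" using energy_convergent[OF z] by blast
  then have "\<forall>\<^sub>F t in at_top. energy t < e + 1" by (rule order_tendstoD) simp
  then have upper: "\<forall>\<^sub>F t in at_top. \<psi> (x t) \<le> (e + 1 - \<mu>) / \<beta> t"
    using eventually_ge_at_top[of 0]
  proof eventually_elim
    case (elim t)
    have "(norm (v t))\<^sup>2 / 2 + \<phi> (x t) + \<beta> t * \<psi> (x t) < e + 1" using elim by (simp add: energy_def)
    moreover have "0 \<le> (norm (v t))\<^sup>2 / 2" by simp
    ultimately have "\<beta> t * \<psi> (x t) \<le> e + 1 - \<mu>" using mu_le[of "x t"] by linarith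
    then show ?case using beta_pos[OF elim(2)] by (simp add: field_simps)
  qed
  show ?thesis
    by (rule real_tendsto_sandwich[OF _ upper tendsto_const real_tendsto_divide_at_top[OF tendsto_const beta_lim]])
      (simp add: psi_nonneg)
qed

lemma weak_cluster_point_feasible:
  assumes z: "z \<in> S" and G: "G \<noteq> bot" "G \<le> at_top" "weakly_tendsto x l G"
  shows "\<psi> l = 0"
proof -
  have "\<psi> l \<le> \<epsilon>" if "0 < \<epsilon>" for \<epsilon>
  proof (rule weak_limit_value_le[OF psi_convex GDERIV_psi G(3,1)])
    have "\<forall>\<^sub>F t in at_top. \<psi> (x t) < \<epsilon>" by (rule order_tendstoD(2)[OF penalty_value_tendsto_0[OF z] that])
    then show "\<forall>\<^sub>F t in G. \<psi> (x t) \<le> \<epsilon>" by (rule eventually_mono[OF filter_leD[OF G(2)]]) simp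
  qed
  then have "\<psi> l \<le> 0" by (meson dense_ge)
  then show ?thesis using psi_nonneg[of l] by simp
qed

text \<open>Although \<open>x\<close> is infeasible, its weak cluster points are feasible. Times with
  \<open>\<phi>(x) \<le> \<phi>(z) - \<epsilon>\<close> recurring for ever would produce a feasible cluster point with a value below
  the constrained minimum.\<close>
lemma objective_eventually_ge:
  assumes z: "z \<in> S" and "0 < \<epsilon>"
  shows "\<forall>\<^sub>F t in at_top. \<phi> z - \<epsilon> < \<phi> (x t)"
proof (rule ccontr)
  define A where "A = {t. \<not> \<phi> z - \<epsilon> < \<phi> (x t)}"
  assume "\<not> (\<forall>\<^sub>F t in at_top. \<phi> z - \<epsilon> < \<phi> (x t))"
  then have nontriv: "inf at_top (principal A) \<noteq> bot"
    by (simp add: A_def trivial_limit_def eventually_inf_principal)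
  obtain B where "\<forall>\<^sub>F t in at_top. norm (x t - z) \<le> B" using trajectory_bounded[OF z] by blast
  then have "\<forall>\<^sub>F t in inf at_top (principal A). norm (x t) \<le> B + norm z"
    unfolding eventually_inf_principal
  proof eventually_elim
    case (elim t)
    then show ?case using norm_triangle_ineq[of "x t - z" z] by simp
  qed
  then obtain l G where G: "G \<noteq> bot" "G \<le> inf at_top (principal A)" "weakly_tendsto x l G"
    using bounded_imp_weak_cluster_point[OF nontriv] by blast
  have "\<psi> l = 0" using weak_cluster_point_feasible[OF z] G by simp
  moreover have "\<forall>\<^sub>F t in G. t \<in> A" using G(2) by (simp add: le_principal)
  then have "\<forall>\<^sub>F t in G. \<phi> (x t) \<le> \<phi> z - \<epsilon>" by eventually_elim (simp add: A_def)
  then have "\<phi> l \<le> \<phi> z - \<epsilon>" by (rule weak_limit_value_le[OF phi_convex GDERIV_phi G(3,1)])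
  ultimately show False using z \<open>0 < \<epsilon>\<close> by (fastforce simp: S_iff)
qed

text \<open>The limit of the energy is at most \<open>\<phi>(z)\<close>, and \<open>\<phi>(x)\<close> alone is eventually almost \<open>\<phi>(z)\<close>. Nothing
  is left for the nonnegative kinetic and penalty terms.\<close>
lemma
  assumes z: "z \<in> S"
  shows kinetic_plus_penalty_tendsto_0:
      "((\<lambda>t. (norm (v t))\<^sup>2 / 2 + \<beta> t * \<psi> (x t)) \<longlongrightarrow> 0) at_top"
    and objective_tendsto: "((\<lambda>t. \<phi> (x t)) \<longlongrightarrow> \<phi> z) at_top"
proof -
  obtain e where e: "(energy \<longlongrightarrow> e) at_top" using energy_convergent[OF z] by blast
  have upper: "\<forall>\<^sub>F t in at_top. energy t < \<phi> z + \<epsilon>" if "0 < \<epsilon>" for \<epsilon>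
    by (rule order_tendstoD(2)[OF e]) (use energy_limit_le[OF z e] that in simp)
  show *: "((\<lambda>t. (norm (v t))\<^sup>2 / 2 + \<beta> t * \<psi> (x t)) \<longlongrightarrow> 0) at_top"
  proof (rule tendstoI)
    fix \<epsilon> :: real assume \<epsilon>: "0 < \<epsilon>"
    show "\<forall>\<^sub>F t in at_top. dist ((norm (v t))\<^sup>2 / 2 + \<beta> t * \<psi> (x t)) 0 < \<epsilon>"
      using upper[of "\<epsilon> / 2", OF half_gt_zero[OF \<epsilon>]]
        objective_eventually_ge[OF z half_gt_zero[OF \<epsilon>]] eventually_ge_at_top[of 0]
    proof eventually_elim
      case (elim t)
      have "\<bar>(norm (v t))\<^sup>2 / 2 + \<beta> t * \<psi> (x t)\<bar> = energy t - \<phi> (x t)"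
        using penalty_nonneg[OF elim(3)] by (simp add: energy_def)
      then show ?case using elim(1,2) by simp
    qed
  qed
  have "((\<lambda>t. energy t - ((norm (v t))\<^sup>2 / 2 + \<beta> t * \<psi> (x t))) \<longlongrightarrow> e - 0) at_top"
    by (intro tendsto_diff e *)
  then have phi: "((\<lambda>t. \<phi> (x t)) \<longlongrightarrow> e) at_top" by (simp add: energy_def)
  have "\<phi> z - \<epsilon> \<le> e" if "0 < \<epsilon>" for \<epsilon>
    by (rule tendsto_lowerbound[OF phi])
      (use objective_eventually_ge[OF z that] in \<open>auto elim: eventually_mono\<close>)
  then have "\<phi> z \<le> e" by (meson field_le_epsilon diff_le_eq)
  then show "((\<lambda>t. \<phi> (x t)) \<longlongrightarrow> \<phi> z) at_top" using phi energy_limit_le[OF z e] by simp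
qed

lemma penalty_tendsto_0:
  assumes z: "z \<in> S"
  shows "((\<lambda>t. \<beta> t * \<psi> (x t)) \<longlongrightarrow> 0) at_top"
  by (rule real_tendsto_sandwich[OF _ _ tendsto_const kinetic_plus_penalty_tendsto_0[OF z]])
    (auto intro!: eventually_mono[OF eventually_ge_at_top[of 0]] penalty_nonneg)

lemma velocity_tendsto_0:
  assumes z: "z \<in> S"
  shows "(v \<longlongrightarrow> 0) at_top"
proof -
  have "((\<lambda>t. sqrt (2 * (((norm (v t))\<^sup>2 / 2 + \<beta> t * \<psi> (x t)) - \<beta> t * \<psi> (x t)))) \<longlongrightarrow> sqrt (2 * (0 - 0))) at_top"
    by (intro tendsto_intros kinetic_plus_penalty_tendsto_0[OF z] penalty_tendsto_0[OF z])
  then show ?thesis by (simp add: tendsto_norm_zero_iff)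
qed

text \<open>The anchor is \<open>Lyapunov z - c * energy\<close> and converges. Its part \<open>\<langle>x - z, v\<rangle>\<close> tends to \<open>0\<close>, as the
  trajectory is bounded and \<open>v\<close> tends to \<open>0\<close>; the rest is a multiple of \<open>\<parallel>x - z\<parallel>\<^sup>2\<close>.\<close>
lemma distance_convergent:
  assumes z: "z \<in> S"
  shows "\<exists>r. ((\<lambda>t. (norm (x t - z))\<^sup>2) \<longlongrightarrow> r) at_top"
proof -
  obtain B where "\<forall>\<^sub>F t in at_top. norm (x t - z) \<le> B" using trajectory_bounded[OF z] by blast
  then have "\<forall>\<^sub>F t in at_top. norm (inner (x t - z) (v t)) \<le> B * norm (v t)"
  proof eventually_elim
    case (elim t)
    then show ?case
      using Cauchy_Schwarz_ineq2[of "x t - z" "v t"] mult_right_mono[OF elim, of "norm (v t)"] by simp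
  qed
  moreover have "((\<lambda>t. B * norm (v t)) \<longlongrightarrow> 0) at_top"
    using velocity_tendsto_0[OF z] by (auto intro!: tendsto_eq_intros)
  ultimately have cross: "((\<lambda>t. inner (x t - z) (v t)) \<longlongrightarrow> 0) at_top" by (rule Lim_null_comparison)
  obtain e where e: "(energy \<longlongrightarrow> e) at_top" using energy_convergent[OF z] by blast
  obtain l where l: "(Lyapunov z \<longlongrightarrow> l) at_top" using Lyapunov_convergent[OF z] by blast
  have "((\<lambda>t. 2 / \<gamma> * (Lyapunov z t - c * energy t - inner (x t - z) (v t)))
      \<longlongrightarrow> 2 / \<gamma> * (l - c * e - 0)) at_top"
    by (intro tendsto_intros l e cross)
  also have "(\<lambda>t. 2 / \<gamma> * (Lyapunov z t - c * energy t - inner (x t - z) (v t))) = (\<lambda>t. (norm (x t - z))\<^sup>2)"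
    using gamma by (auto simp: Lyapunov_def anchor_def)
  finally show ?thesis by blast
qed

lemma trajectory_weakly_convergent:
  assumes z: "z \<in> S"
  obtains l where "l \<in> S" "weakly_tendsto x l at_top"
proof -
  obtain B where "\<forall>\<^sub>F t in at_top. norm (x t - z) \<le> B" using trajectory_bounded[OF z] by blast
  then have bdd: "\<forall>\<^sub>F t in at_top. norm (x t) \<le> B + norm z"
  proof eventually_elim
    case (elim t)
    then show ?case using norm_triangle_ineq[of "x t - z" z] by simp
  qed
  show thesis
  proof (rule Opial[OF _ bdd distance_convergent _ that])
    fix l G assume G: "G \<noteq> bot" "G \<le> at_top" "weakly_tendsto x l G"
    have "\<phi> l \<le> \<phi> z + \<epsilon>" if "0 < \<epsilon>" for \<epsilon>
    proof (rule weak_limit_value_le[OF phi_convex GDERIV_phi G(3,1)])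
      have "\<forall>\<^sub>F t in at_top. \<phi> (x t) < \<phi> z + \<epsilon>"
        by (rule order_tendstoD(2)[OF objective_tendsto[OF z]]) (use that in simp)
      then show "\<forall>\<^sub>F t in G. \<phi> (x t) \<le> \<phi> z + \<epsilon>"
        by (rule eventually_mono[OF filter_leD[OF G(2)]]) simp
    qed
    then have "\<phi> l \<le> \<phi> z" by (rule field_le_epsilon)
    then show "l \<in> S" using z weak_cluster_point_feasible[OF z G] by (fastforce simp: S_iff)
  qed auto
qed

end

section \<open>Convergence of the trajectory\<close>

theorem theorem8:
  fixes \<phi> \<psi> :: "'a::{real_inner, complete_space} \<Rightarrow> real"
    and \<beta> \<beta>' :: "real \<Rightarrow> real"
    and \<gamma> k :: real
    and u\<^sub>0 v\<^sub>0 :: 'a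
    and x :: "real \<Rightarrow> 'a"
  assumes gamma: "0 < \<gamma>"
    and psi_nonneg: "\<And>z. 0 \<le> \<psi> z"
    and psi_convex: "convex_on UNIV \<psi>"
    and psi_diff: "\<And>z. \<psi> differentiable (at z)"
    and psi_lipschitz: "\<exists>L. L-lipschitz_on UNIV (gradient \<psi>)"
    and psi_argmin: "argmin \<psi> = \<psi> -` {0}"
    and psi_argmin_ne: "argmin \<psi> \<noteq> {}"
    and phi_convex: "convex_on UNIV \<phi>"
    and phi_diff: "\<And>z. \<phi> differentiable (at z)"
    and phi_lipschitz: "\<exists>L. L-lipschitz_on UNIV (gradient \<phi>)"
    and phi_bdd: "bdd_below (range \<phi>)"
    and S_ne: "argmin_on (argmin \<psi>) \<phi> \<noteq> {}"
    and beta_pos: "\<And>t. 0 \<le> t \<Longrightarrow> 0 < \<beta> t"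
    and beta_deriv: "\<And>t. 0 \<le> t \<Longrightarrow> (\<beta> has_real_derivative \<beta>' t) (at t within {0..})"
    and beta_C1: "continuous_on {0..} \<beta>'"
    and k: "0 \<le> k" "k < \<gamma>"
    and beta_growth: "\<And>t. 0 \<le> t \<Longrightarrow> 0 \<le> \<beta>' t \<and> \<beta>' t \<le> k * \<beta> t"
    and H: "\<And>p. p \<in> ran_normal_cone (argmin \<psi>) \<Longrightarrow>
          (\<integral>\<^sup>+ t \<in> {0..}. e2ennreal (ereal (\<beta> t) *
             (fenchel_conjugate \<psi> (p /\<^sub>R \<beta> t) - support_function (argmin \<psi>) (p /\<^sub>R \<beta> t)))
           \<partial>lborel) < \<infinity>"
    and beta_lim: "filterlim \<beta> at_top at_top"
    and sol: "strong_global_solution \<gamma> \<phi> \<psi> \<beta> u\<^sub>0 v\<^sub>0 x"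
  shows "((\<lambda>t. \<phi> (x t)) \<longlongrightarrow> (INF y\<in>argmin \<psi>. \<phi> y)) at_top
    \<and> (((\<lambda>t. \<beta> t * \<psi> (x t)) \<longlongrightarrow> 0) at_top \<and> ((\<lambda>t. \<psi> (x t)) \<longlongrightarrow> 0) at_top)
    \<and> set_integrable lborel {0..} (\<lambda>t. \<beta> t * \<psi> (x t))
    \<and> set_integrable lborel {0..} (\<lambda>t. (norm (time_deriv x t))\<^sup>2)
    \<and> (time_deriv x \<longlongrightarrow> 0) at_top
    \<and> (\<exists>x_inf \<in> argmin_on (argmin \<psi>) \<phi>. weakly_tendsto x x_inf at_top)"
proof -
  define v where "v = time_deriv x"
  have x_deriv: "(x has_vector_derivative v t) (at t within {0..})" if "0 \<le> t" for t
    using sol that unfolding strong_global_solution_def v_def time_deriv_def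
    by (simp add: vector_derivative_works)
  have phi_cont: "continuous_on UNIV (gradient \<phi>)" and psi_cont: "continuous_on UNIV (gradient \<psi>)"
    using phi_lipschitz psi_lipschitz lipschitz_on_continuous_on by blast+
  have v_deriv: "(v has_vector_derivative
      - (\<gamma> *\<^sub>R v t) - gradient \<phi> (x t) - \<beta> t *\<^sub>R gradient \<psi> (x t)) (at t within {0..})"
    if t: "0 \<le> t" for t
  proof (rule locally_absolutely_continuous_C1[OF _ _ _ t])
    show lac: "locally_absolutely_continuous v" using sol by (simp add: strong_global_solution_def v_def)
    have cont_x: "continuous_on {0..} x"
      using x_deriv
      by (auto simp: continuous_on_eq_continuous_within intro: has_vector_derivative_continuous)
    have cont_beta: "continuous_on {0..} \<beta>"
      using beta_deriv by (auto simp: continuous_on_eq_continuous_within intro: DERIV_continuous)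
    show "continuous_on {0..} (\<lambda>t. - (\<gamma> *\<^sub>R v t) - gradient \<phi> (x t) - \<beta> t *\<^sub>R gradient \<psi> (x t))"
      by (intro continuous_intros locally_absolutely_continuous_imp_continuous[OF lac] cont_beta
          continuous_on_compose2[OF phi_cont cont_x] continuous_on_compose2[OF psi_cont cont_x]) auto
    have "AE t in lborel. 0 \<le> t \<longrightarrow> v differentiable (at t within {0..}) \<and>
        time_deriv v t + \<gamma> *\<^sub>R v t + gradient \<phi> (x t) + \<beta> t *\<^sub>R gradient \<psi> (x t) = 0"
      using sol by (simp add: strong_global_solution_def v_def)
    then show "AE t in lborel. 0 \<le> t \<longrightarrow> (v has_vector_derivative
        - (\<gamma> *\<^sub>R v t) - gradient \<phi> (x t) - \<beta> t *\<^sub>R gradient \<psi> (x t)) (at t within {0..})"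
    proof eventually_elim
      case (elim t)
      show ?case
      proof
        assume "0 \<le> t"
        with elim have "(v has_vector_derivative time_deriv v t) (at t within {0..})"
          and eq: "time_deriv v t + \<gamma> *\<^sub>R v t + gradient \<phi> (x t) + \<beta> t *\<^sub>R gradient \<psi> (x t) = 0"
          by (simp_all add: time_deriv_def vector_derivative_works)
        moreover have "time_deriv v t = - (\<gamma> *\<^sub>R v t) - gradient \<phi> (x t) - \<beta> t *\<^sub>R gradient \<psi> (x t)"
          using eq by (simp add: eq_neg_iff_add_eq_0 algebra_simps)
        ultimately show "(v has_vector_derivative
            - (\<gamma> *\<^sub>R v t) - gradient \<phi> (x t) - \<beta> t *\<^sub>R gradient \<psi> (x t)) (at t within {0..})"
          by simp
      qed
    qed
  qed
  interpret penalised_dynamics \<phi> \<psi> \<beta> \<beta>' \<gamma> k x v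
    by unfold_locales
      (rule gamma psi_nonneg psi_convex psi_diff psi_argmin phi_convex phi_diff phi_bdd beta_pos
        beta_deriv k beta_growth[THEN conjunct2] H beta_lim x_deriv v_deriv | assumption)+
  obtain z where z: "z \<in> S" using S_ne by blast
  have "(INF y\<in>argmin \<psi>. \<phi> y) = \<phi> z"
    by (rule cInf_eq_minimum) (use z in \<open>auto simp: S_iff C_iff\<close>)
  moreover obtain B where
    v_bound: "\<And>t. 0 \<le> t \<Longrightarrow> integral {0..t} (\<lambda>t. (norm (v t))\<^sup>2) \<le> B" and
    penalty_bound: "\<And>t. 0 \<le> t \<Longrightarrow> integral {0..t} (\<lambda>t. \<beta> t * \<psi> (x t)) \<le> B"
    using dissipation_integral_bounded[OF z] by blast
  have "set_integrable lborel {0..} (\<lambda>t. \<beta> t * \<psi> (x t))"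
    by (rule set_integrable_half_line[OF _ penalty_nonneg penalty_bound])
      (intro continuous_intros continuous_beta continuous_psi_x)
  moreover have "set_integrable lborel {0..} (\<lambda>t. (norm (v t))\<^sup>2)"
    by (rule set_integrable_half_line[OF _ _ v_bound]) (intro continuous_intros continuous_v | simp)+
  moreover obtain l where "l \<in> S" "weakly_tendsto x l at_top"
    using trajectory_weakly_convergent[OF z] .
  ultimately show ?thesis
    using objective_tendsto[OF z] penalty_tendsto_0[OF z] penalty_value_tendsto_0[OF z]
      velocity_tendsto_0[OF z]
    unfolding v_def by auto
qed

end
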